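(* Let $\boldsymbol{\mathsf A}^n=\boldsymbol{\mathsf A}^{\mathrm H,n}=\mathrm{diag}(\mathsf A_{\mathbf x}^{\mathrm H,n},\mathsf A_{\mathbf v}^{\mathrm H,n})$ be the residual-based artificial viscosity defined in the context. Then the forward Euler scheme $$\sum_{j\in\mathcal I}m_{ij}\frac{f_j^{n+1}-f_j^n}{\tau_n}+\sum_{j\in\mathcal I}c_{ij}^nf_j^n+\sum_{j\in\mathcal I}d_{ij}^nf_j^n=0\qquad\forall i\in\mathcal I,$$ where $m_{ij}=(\psi_j,\psi_i)$, $c_{ij}^n=(\boldsymbol\beta_h^n\cdot\nabla\psi_j,\psi_i)$ and $d_{ij}^n=(\boldsymbol{\mathsf A}^n\nabla\psi_j,\nabla\psi_i)$, is conservative, i.e. $f_h^n=\sum_{j\in\mathcal I}f_j^n\psi_j$ satisfies $$\int_\Omega f_h^{n+1}\,d\mathbf x\,d\mathbf v=\int_\Omega f_h^{n}\,d\mathbf x\,d\mathbf v\qquad\text{for all } n\ge0.$$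
   Context: Setting. $\Omega=\Omega_{\mathbf x}\times\Omega_{\mathbf v}$ with boxes $\Omega_{\mathbf x}\subset\mathbb R^{d_{\mathbf x}}$, $\Omega_{\mathbf v}\subset\mathbb R^{d_{\mathbf v}}$ and periodic boundary conditions in all directions. Each box is partitioned by a Cartesian mesh of cuboids with mesh sizes $\Delta x_l$ ($l=1,\dots,d_{\mathbf x}$) and $\Delta v_l$ ($l=1,\dots,d_{\mathbf v}$). $\mathbb V_{\mathbf x}$, $\mathbb V_{\mathbf v}$ are the corresponding (periodic) spaces of continuous piecewise $\mathbb Q_k$ functions (degree at most $k\geq 1$ in each variable), with Lagrange bases $\{\phi_i\}_{i\in\mathcal I_{\mathbf x}}$, $\{\varphi_j\}_{j\in\mathcal I_{\mathbf v}}$ and $N_{\mathbf x}=\dim\mathbb V_{\mathbf x}$, $N_{\mathbf v}=\dim\mathbb V_{\mathbf v}$. $\mathbb V=\mathbb V_{\mathbf x}\otimes\mathbb V_{\mathbf v}$ has Lagrange basis $\{\psi_i\}_{i\in\mathcal I}$, also double-indexed as $\psi_{i,j}=\phi_i\varphi_j$ ($i\in\mathcal I_{\mathbf x}$, $j\in\mathcal I_{\mathbf v}$); nodal values in $\mathbb V$ are double-indexed likewise. $S_x(i),S_v(j),S(l)$ denote the supports of $\phi_i,\varphi_j,\psi_l$ (and the sets of nodes in them). $(\cdot,\cdot)$ is the $L^2$ inner product on the relevant domain, $\nabla=(\nabla_{\mathbf x},\nabla_{\mathbf v})^\top$, and $\tau_n>0$ is the time step. The advection field is $\boldsymbol\beta_h^n=(\boldsymbol\beta_{\mathbf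 x},\boldsymbol\beta_{\mathbf v})^\top=(\mathbf v,\ \mathbf E_h^n+\mathbf v\times\mathbf B_h^n)^\top$, where $\mathbf E_h^n(\mathbf x),\mathbf B_h^n(\mathbf x)$ are the piecewise polynomial finite element electric and magnetic fields at time $t_n$ (in reduced dimensions, the relevant components are retained, e.g. $\boldsymbol\beta=(v_1,v_2,E_1+v_2B_3,E_2-v_1B_3)$ for $d_{\mathbf x}=d_{\mathbf v}=2$). First-order viscosity: for $i\in\mathcal I$, $$(\epsilon^{\mathrm L,n}_{x_l})_i=\tfrac12\tfrac{\Delta x_l}{k}\|\beta_{x_l}\|_{L^\infty(S(i))},\qquad(\epsilon^{\mathrm L,n}_{v_l})_i=\tfrac12\tfrac{\Delta v_l}{k}\|\beta_{v_l}\|_{L^\infty(S(i))},$$ and its averages $$(\nu^{\mathrm L,n}_{x_l})_i=\tfrac1{N_{\mathbf v}}\sum_{j\in\mathcal I_{\mathbf v}}(\epsilon^{\mathrm L,n}_{x_l})_{i,j}\ (i\in\mathcal I_{\mathbf x}),\qquad(\nu^{\mathrm L,n}_{v_l})_i=\tfrac1{N_{\mathbf x}}\sum_{j\in\mathcal I_{\mathbf x}}(\epsilon^{\mathrm L,n}_{v_l})_{j,i}\ (i\in\mathcal I_{\mathbf v}).$$ Residuals: let $u^n_{h,x}=\int_{\Omega_{\mathbf v}}f_h^n\,d\mathbf v\in\mathbb V_{\mathbf x}$ and $\mathbf F^n_{h,\mathbf x}=\int_{\Omega_{\mathbf v}}\boldsymbol\beta_{\mathbf x}f_h^n\,d\mathbf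 v$; $u^n_{h,v}=\int_{\Omega_{\mathbf x}}f_h^n\,d\mathbf x\in\mathbb V_{\mathbf v}$, and $\mathbf F^n_{h,\mathbf v}$ the finite element function on $\Omega_{\mathbf v}$ whose nodal values are those of $\int_{\Omega_{\mathbf x}}\boldsymbol\beta_{\mathbf v}f_h^n\,d\mathbf x$. $R_x^n\in\mathbb V_{\mathbf x}$ and $R_v^n\in\mathbb V_{\mathbf v}$ are defined by $$(R_x^n,\phi_i)=(|D_\tau u^n_{h,x}+\nabla_{\mathbf x}\cdot\mathbf F^n_{h,\mathbf x}|,\phi_i)\ \forall i\in\mathcal I_{\mathbf x},\qquad(R_v^n,\varphi_j)=(|D_\tau u^n_{h,v}+\nabla_{\mathbf v}\cdot\mathbf F^n_{h,\mathbf v}|,\varphi_j)\ \forall j\in\mathcal I_{\mathbf v},$$ where $D_\tau$ is the approximation of the time derivative at $t_n$ by the second-order backward difference formula BDF2 (for uniform time steps, $D_\tau u^n=(3u^n-4u^{n-1}+u^{n-2})/(2\tau_n)$). Normalization: for $\mathbf z\in\{\mathbf x,\mathbf v\}$ (with $z\in\{x,v\}$ the matching subscript), with $u^n_{z,j}$ the nodal values of $u^n_{h,z}$ and $\overline{w}$ the mean value of $w$ over $\Omega_{\mathbf z}$, $$\Lambda_{\mathbf z_i}=\Big(1-0.5\,\frac{\max_{j\in S_z(i)}u^n_{z,j}-\min_{j\in S_z(i)}u^n_{z,j}}{\max_{j\in\mathcal I_{\mathbf z}}u^n_{z,j}-\min_{j\in\mathcal I_{\mathbf z}}u^n_{z,j}}\Big)\,\big\|u^n_{h,z}-\overline{u^n_{h,z}}\big\|_{L^\infty(\Omega_{\mathbf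 z})},\quad i\in\mathcal I_{\mathbf z}$$ (quotients are assumed well defined; in practice a zero denominator is avoided by regularizing the quotient). High-order viscosity: nodal values $$(\nu^{\mathrm H,n}_{x_l})_i=\min\Big((\nu^{\mathrm L,n}_{x_l})_i,\Big(\frac{\Delta x_l}{k}\Big)^2\frac{|R^n_{x,i}|}{\Lambda_{\mathbf x_i}}\frac{d_{\mathbf x}}{d_{\mathbf x}+d_{\mathbf v}}\Big),\quad i\in\mathcal I_{\mathbf x},$$ $$(\nu^{\mathrm H,n}_{v_l})_i=\min\Big((\nu^{\mathrm L,n}_{v_l})_i,\Big(\frac{\Delta v_l}{k}\Big)^2\frac{|R^n_{v,i}|}{\Lambda_{\mathbf v_i}}\frac{d_{\mathbf v}}{d_{\mathbf x}+d_{\mathbf v}}\Big),\quad i\in\mathcal I_{\mathbf v},$$ where $R^n_{x,i},R^n_{v,i}$ are nodal values. These define functions $\nu^{\mathrm H,n}_{x_l}\in\mathbb V_{\mathbf x}$, $\nu^{\mathrm H,n}_{v_l}\in\mathbb V_{\mathbf v}$, and $\mathsf A^{\mathrm H,n}_{\mathbf x}=\mathrm{diag}(\nu^{\mathrm H,n}_{x_1},\dots,\nu^{\mathrm H,n}_{x_{d_{\mathbf x}}})$, $\mathsf A^{\mathrm H,n}_{\mathbf v}=\mathrm{diag}(\nu^{\mathrm H,n}_{v_1},\dots,\nu^{\mathrm H,n}_{v_{d_{\mathbf v}}})$. *)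

theory Defs
  imports "HOL-Analysis.Analysis" "HOL-Probability.Essential_Supremum"
begin

text \<open>
  A periodic \<open>Q\<^sub>k\<close> finite element structure on the box with lower corner \<open>corner\<close>, divided in
  direction \<open>l\<close> into \<open>ncells $ l\<close> intervals of length \<open>msize $ l\<close>.  The Lagrange nodes are the
  images of arbitrary reference nodes \<open>0 = refnode 0 < \<dots> < refnode k = 1\<close> with \<open>k = degr\<close>.
\<close>

record 'd fe =
  corner :: "real^'d"
  msize :: "real^'d"
  ncells :: "nat^'d"
  degr :: nat
  refnode :: "nat \<Rightarrow> real"
  shape :: "nat^'d \<Rightarrow> real^'d \<Rightarrow> real"

definition dom_box :: "('d::finite) fe \<Rightarrow> (real^'d) set" where
  "dom_box Z = cbox (corner Z) (\<chi> l. corner Z $ l + msize Z $ l * real (ncells Z $ l))"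

definition cells :: "('d::finite) fe \<Rightarrow> (nat^'d) set" where
  "cells Z = {c. \<forall>l. c $ l < ncells Z $ l}"

definition cell_lo :: "('d::finite) fe \<Rightarrow> nat^'d \<Rightarrow> real^'d" where
  "cell_lo Z c = (\<chi> l. corner Z $ l + msize Z $ l * real (c $ l))"

definition cell_hi :: "('d::finite) fe \<Rightarrow> nat^'d \<Rightarrow> real^'d" where
  "cell_hi Z c = (\<chi> l. corner Z $ l + msize Z $ l * (real (c $ l) + 1))"

definition Qpoly :: "nat \<Rightarrow> (real^('d::finite) \<Rightarrow> real) set" where
  "Qpoly k = {p. \<exists>a :: nat^'d \<Rightarrow> real.
     \<forall>x. p x = (\<Sum>\<alpha> | \<forall>l. \<alpha> $ l \<le> k. a \<alpha> * (\<Prod>l\<in>UNIV. (x $ l) ^ (\<alpha> $ l)))}"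

text \<open>
  Functions on the periodic box are represented by their periodic extensions to the whole space,
  so continuity on the whole space includes continuity across the identified faces.
\<close>

definition fe_space :: "('d::finite) fe \<Rightarrow> (real^'d \<Rightarrow> real) set" where
  "fe_space Z = {u. continuous_on UNIV u \<and>
     (\<forall>l x. u (x + (msize Z $ l * real (ncells Z $ l)) *\<^sub>R axis l 1) = u x) \<and>
     (\<forall>c\<in>cells Z. \<exists>p\<in>Qpoly (degr Z). \<forall>x\<in>cbox (cell_lo Z c) (cell_hi Z c). u x = p x)}"

text \<open>
  On the torus there are \<open>k\<close> nodes per cell and direction; every node is represented by its copy
  in the box without its upper faces.  The number of nodes is the dimension of \<open>fe_space\<close>.
\<close>

definition idx :: "('d::finite) fe \<Rightarrow> (nat^'d) set" where
  "idx Z = {i. \<forall>l. i $ l < ncells Z $ l * degr Z}"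

definition node :: "('d::finite) fe \<Rightarrow> nat^'d \<Rightarrow> real^'d" where
  "node Z i = (\<chi> l. corner Z $ l
     + msize Z $ l * (real (i $ l div degr Z) + refnode Z (i $ l mod degr Z)))"

definition lagrange_fe :: "('d::finite) fe \<Rightarrow> bool" where
  "lagrange_fe Z \<longleftrightarrow>
     (\<forall>l. msize Z $ l > 0) \<and> (\<forall>l. ncells Z $ l \<ge> 1) \<and> degr Z \<ge> 1 \<and>
     refnode Z 0 = 0 \<and> refnode Z (degr Z) = 1 \<and> strict_mono_on {..degr Z} (refnode Z) \<and>
     (\<forall>i\<in>idx Z. shape Z i \<in> fe_space Z \<and>
        (\<forall>j\<in>idx Z. shape Z i (node Z j) = (if i = j then 1 else 0)))"

definition interp :: "('d::finite) fe \<Rightarrow> (nat^'d \<Rightarrow> real) \<Rightarrow> real^'d \<Rightarrow> real" where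
  "interp Z a x = (\<Sum>i\<in>idx Z. a i * shape Z i x)"

text \<open>
  The fields need not be continuous across cell interfaces, and their values there are irrelevant.
\<close>

definition piecewise_polynomial :: "('d::finite) fe \<Rightarrow> (real^'d \<Rightarrow> real^3) \<Rightarrow> bool" where
  "piecewise_polynomial Z F \<longleftrightarrow>
     (\<forall>c\<in>cells Z. \<exists>P. polynomial_function P \<and>
        (\<forall>x\<in>box (cell_lo Z c) (cell_hi Z c). F x = P x))"

definition l2ip :: "'a::euclidean_space set \<Rightarrow> ('a \<Rightarrow> 'b::real_inner) \<Rightarrow> ('a \<Rightarrow> 'b) \<Rightarrow> real" where
  "l2ip S g h = (LINT z:S|lebesgue. g z \<bullet> h z)"

definition Linf :: "'a::euclidean_space set \<Rightarrow> ('a \<Rightarrow> real) \<Rightarrow> real" where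
  "Linf S g = real_of_ereal (esssup (lebesgue_on S) (\<lambda>z. ereal \<bar>g z\<bar>))"

definition supp :: "('a::topological_space \<Rightarrow> real) \<Rightarrow> 'a set" where
  "supp g = closure {z. g z \<noteq> 0}"

text \<open>
  Partial derivatives of piecewise polynomials are unspecified at the points of the cell
  interfaces where they do not exist; these form a null set.
\<close>

definition partial :: "'d \<Rightarrow> (real^('d::finite) \<Rightarrow> real) \<Rightarrow> real^'d \<Rightarrow> real" where
  "partial l g x = deriv (\<lambda>s. g (x + s *\<^sub>R axis l 1)) 0"

definition divergence :: "(real^('d::finite) \<Rightarrow> real^'d) \<Rightarrow> real^'d \<Rightarrow> real" where
  "divergence F x = (\<Sum>l\<in>UNIV. partial l (\<lambda>y. F y $ l) x)"

definition grad :: "((real^('dx::finite)) \<times> (real^('dv::finite)) \<Rightarrow> real)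
    \<Rightarrow> (real^'dx) \<times> (real^'dv) \<Rightarrow> (real^'dx) \<times> (real^'dv)" where
  "grad g z = ((\<chi> l. partial l (\<lambda>x. g (x, snd z)) (fst z)),
               (\<chi> l. partial l (\<lambda>v. g (fst z, v)) (snd z)))"

text \<open>
  Reduced dimensions: \<open>cx\<close> and \<open>cv\<close> say which of the three Cartesian components are retained in
  \<open>x\<close> and \<open>v\<close>.  The velocity is padded by zeros to a vector in three dimensions.
\<close>

definition vel3 :: "('dv::finite \<Rightarrow> 3) \<Rightarrow> real^'dv \<Rightarrow> real^3" where
  "vel3 cv v = (\<chi> m. \<Sum>l | cv l = m. v $ l)"

definition advection :: "('dx::finite \<Rightarrow> 3) \<Rightarrow> ('dv::finite \<Rightarrow> 3) \<Rightarrow> (real^'dx \<Rightarrow> real^3)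
    \<Rightarrow> (real^'dx \<Rightarrow> real^3) \<Rightarrow> (real^'dx) \<times> (real^'dv) \<Rightarrow> (real^'dx) \<times> (real^'dv)" where
  "advection cx cv E B z =
     ((\<chi> l. vel3 cv (snd z) $ cx l),
      (\<chi> l. (E (fst z) + cross3 (vel3 cv (snd z)) (B (fst z))) $ cv l))"

definition psi :: "('dx::finite) fe \<Rightarrow> ('dv::finite) fe \<Rightarrow> (nat^'dx) \<times> (nat^'dv)
    \<Rightarrow> (real^'dx) \<times> (real^'dv) \<Rightarrow> real" where
  "psi X V i z = shape X (fst i) (fst z) * shape V (snd i) (snd z)"

definition fh :: "('dx::finite) fe \<Rightarrow> ('dv::finite) fe \<Rightarrow> ((nat^'dx) \<times> (nat^'dv) \<Rightarrow> real)
    \<Rightarrow> (real^'dx) \<times> (real^'dv) \<Rightarrow> real" where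
  "fh X V a z = (\<Sum>j\<in>idx X \<times> idx V. a j * psi X V j z)"

definition dens_x :: "('dx::finite) fe \<Rightarrow> ('dv::finite) fe \<Rightarrow> ((nat^'dx) \<times> (nat^'dv) \<Rightarrow> real)
    \<Rightarrow> real^'dx \<Rightarrow> real" where
  "dens_x X V a x = (LINT v:dom_box V|lebesgue. fh X V a (x, v))"

definition dens_v :: "('dx::finite) fe \<Rightarrow> ('dv::finite) fe \<Rightarrow> ((nat^'dx) \<times> (nat^'dv) \<Rightarrow> real)
    \<Rightarrow> real^'dv \<Rightarrow> real" where
  "dens_v X V a v = (LINT x:dom_box X|lebesgue. fh X V a (x, v))"

definition flux_x :: "('dx::finite) fe \<Rightarrow> ('dv::finite) fe
    \<Rightarrow> ((real^'dx) \<times> (real^'dv) \<Rightarrow> (real^'dx) \<times> (real^'dv))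
    \<Rightarrow> ((nat^'dx) \<times> (nat^'dv) \<Rightarrow> real) \<Rightarrow> real^'dx \<Rightarrow> real^'dx" where
  "flux_x X V \<beta> a x = (\<chi> l. LINT v:dom_box V|lebesgue. fst (\<beta> (x, v)) $ l * fh X V a (x, v))"

definition flux_v :: "('dx::finite) fe \<Rightarrow> ('dv::finite) fe
    \<Rightarrow> ((real^'dx) \<times> (real^'dv) \<Rightarrow> (real^'dx) \<times> (real^'dv))
    \<Rightarrow> ((nat^'dx) \<times> (nat^'dv) \<Rightarrow> real) \<Rightarrow> real^'dv \<Rightarrow> real^'dv" where
  "flux_v X V \<beta> a v = (\<chi> l. interp V (\<lambda>j. LINT x:dom_box X|lebesgue.
      snd (\<beta> (x, node V j)) $ l * fh X V a (x, node V j)) v)"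

text \<open>
  BDF2 with variable steps: the derivative at \<open>t n\<close> of the quadratic interpolant of \<open>w\<close> at
  \<open>t n\<close>, \<open>t (n-1)\<close>, \<open>t (n-2)\<close>.  For a uniform step \<open>\<tau>\<close> this is
  \<open>(3 w n - 4 w (n-1) + w (n-2)) / (2 \<tau>)\<close>.
\<close>

definition bdf2 :: "(int \<Rightarrow> real) \<Rightarrow> (int \<Rightarrow> real) \<Rightarrow> int \<Rightarrow> real" where
  "bdf2 t w n = (let a = t n - t (n - 1); b = t (n - 1) - t (n - 2) in
     (2 * a + b) / (a * (a + b)) * w n - (a + b) / (a * b) * w (n - 1)
     + a / (b * (a + b)) * w (n - 2))"

definition abs_projection :: "('d::finite) fe \<Rightarrow> (real^'d \<Rightarrow> real) \<Rightarrow> (real^'d \<Rightarrow> real) \<Rightarrow> bool" where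
  "abs_projection Z r R \<longleftrightarrow> R \<in> fe_space Z \<and>
     (\<forall>i\<in>idx Z. l2ip (dom_box Z) R (shape Z i) = l2ip (dom_box Z) (\<lambda>x. \<bar>r x\<bar>) (shape Z i))"

definition residual_x :: "('dx::finite) fe \<Rightarrow> ('dv::finite) fe \<Rightarrow> (int \<Rightarrow> real)
    \<Rightarrow> (int \<Rightarrow> (real^'dx) \<times> (real^'dv) \<Rightarrow> (real^'dx) \<times> (real^'dv))
    \<Rightarrow> (int \<Rightarrow> (nat^'dx) \<times> (nat^'dv) \<Rightarrow> real) \<Rightarrow> int \<Rightarrow> real^'dx \<Rightarrow> real" where
  "residual_x X V t \<beta> f n x =
     bdf2 t (\<lambda>m. dens_x X V (f m) x) n + divergence (flux_x X V (\<beta> n) (f n)) x"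

definition residual_v :: "('dx::finite) fe \<Rightarrow> ('dv::finite) fe \<Rightarrow> (int \<Rightarrow> real)
    \<Rightarrow> (int \<Rightarrow> (real^'dx) \<times> (real^'dv) \<Rightarrow> (real^'dx) \<times> (real^'dv))
    \<Rightarrow> (int \<Rightarrow> (nat^'dx) \<times> (nat^'dv) \<Rightarrow> real) \<Rightarrow> int \<Rightarrow> real^'dv \<Rightarrow> real" where
  "residual_v X V t \<beta> f n v =
     bdf2 t (\<lambda>m. dens_v X V (f m) v) n + divergence (flux_v X V (\<beta> n) (f n)) v"

definition mean :: "'a::euclidean_space set \<Rightarrow> ('a \<Rightarrow> real) \<Rightarrow> real" where
  "mean S w = (LINT x:S|lebesgue. w x) / measure lebesgue S"

definition spread :: "('d::finite) fe \<Rightarrow> (nat^'d) set \<Rightarrow> (real^'d \<Rightarrow> real) \<Rightarrow> real" where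
  "spread Z J u = Max ((\<lambda>j. u (node Z j)) ` J) - Min ((\<lambda>j. u (node Z j)) ` J)"

text \<open>
  For \<open>u\<close> in \<open>fe_space\<close> with nonzero \<open>spread\<close> over all nodes the normalization is positive: the
  first factor is at least 1/2 and \<open>u\<close> is not constant.  So this one condition makes all quotients
  well defined.
\<close>

definition normalization :: "('d::finite) fe \<Rightarrow> (real^'d \<Rightarrow> real) \<Rightarrow> nat^'d \<Rightarrow> real" where
  "normalization Z u i =
     (1 - 0.5 * (spread Z {j \<in> idx Z. node Z j \<in> supp (shape Z i)} u / spread Z (idx Z) u))
     * Linf (dom_box Z) (\<lambda>x. u x - mean (dom_box Z) u)"

text \<open>
  Supports are supports of periodic extensions, hence the intersection with the box: the
  advection field is not periodic in \<open>v\<close>.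
\<close>

definition epsL_x :: "('dx::finite) fe \<Rightarrow> ('dv::finite) fe
    \<Rightarrow> ((real^'dx) \<times> (real^'dv) \<Rightarrow> (real^'dx) \<times> (real^'dv))
    \<Rightarrow> 'dx \<Rightarrow> (nat^'dx) \<times> (nat^'dv) \<Rightarrow> real" where
  "epsL_x X V \<beta> l i = 1 / 2 * (msize X $ l / real (degr X)) *
     Linf (supp (psi X V i) \<inter> dom_box X \<times> dom_box V) (\<lambda>z. fst (\<beta> z) $ l)"

definition epsL_v :: "('dx::finite) fe \<Rightarrow> ('dv::finite) fe
    \<Rightarrow> ((real^'dx) \<times> (real^'dv) \<Rightarrow> (real^'dx) \<times> (real^'dv))
    \<Rightarrow> 'dv \<Rightarrow> (nat^'dx) \<times> (nat^'dv) \<Rightarrow> real" where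
  "epsL_v X V \<beta> l i = 1 / 2 * (msize V $ l / real (degr V)) *
     Linf (supp (psi X V i) \<inter> dom_box X \<times> dom_box V) (\<lambda>z. snd (\<beta> z) $ l)"

definition nuL_x :: "('dx::finite) fe \<Rightarrow> ('dv::finite) fe
    \<Rightarrow> ((real^'dx) \<times> (real^'dv) \<Rightarrow> (real^'dx) \<times> (real^'dv)) \<Rightarrow> 'dx \<Rightarrow> nat^'dx \<Rightarrow> real" where
  "nuL_x X V \<beta> l i = 1 / real (card (idx V)) * (\<Sum>j\<in>idx V. epsL_x X V \<beta> l (i, j))"

definition nuL_v :: "('dx::finite) fe \<Rightarrow> ('dv::finite) fe
    \<Rightarrow> ((real^'dx) \<times> (real^'dv) \<Rightarrow> (real^'dx) \<times> (real^'dv)) \<Rightarrow> 'dv \<Rightarrow> nat^'dv \<Rightarrow> real" where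
  "nuL_v X V \<beta> l i = 1 / real (card (idx X)) * (\<Sum>j\<in>idx X. epsL_v X V \<beta> l (j, i))"

definition nuH_x :: "('dx::finite) fe \<Rightarrow> ('dv::finite) fe
    \<Rightarrow> ((real^'dx) \<times> (real^'dv) \<Rightarrow> (real^'dx) \<times> (real^'dv))
    \<Rightarrow> ((nat^'dx) \<times> (nat^'dv) \<Rightarrow> real) \<Rightarrow> (real^'dx \<Rightarrow> real) \<Rightarrow> 'dx \<Rightarrow> nat^'dx \<Rightarrow> real" where
  "nuH_x X V \<beta> a R l i = min (nuL_x X V \<beta> l i)
     ((msize X $ l / real (degr X))\<^sup>2 * (\<bar>R (node X i)\<bar> / normalization X (dens_x X V a) i)
      * (real CARD('dx) / (real CARD('dx) + real CARD('dv))))"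

definition nuH_v :: "('dx::finite) fe \<Rightarrow> ('dv::finite) fe
    \<Rightarrow> ((real^'dx) \<times> (real^'dv) \<Rightarrow> (real^'dx) \<times> (real^'dv))
    \<Rightarrow> ((nat^'dx) \<times> (nat^'dv) \<Rightarrow> real) \<Rightarrow> (real^'dv \<Rightarrow> real) \<Rightarrow> 'dv \<Rightarrow> nat^'dv \<Rightarrow> real" where
  "nuH_v X V \<beta> a R l i = min (nuL_v X V \<beta> l i)
     ((msize V $ l / real (degr V))\<^sup>2 * (\<bar>R (node V i)\<bar> / normalization V (dens_v X V a) i)
      * (real CARD('dv) / (real CARD('dx) + real CARD('dv))))"

definition diag :: "('d \<Rightarrow> real) \<Rightarrow> real^'d^('d::finite)" where
  "diag d = (\<chi> l m. if l = m then d l else 0)"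

definition AH_x :: "('dx::finite) fe \<Rightarrow> ('dv::finite) fe
    \<Rightarrow> ((real^'dx) \<times> (real^'dv) \<Rightarrow> (real^'dx) \<times> (real^'dv))
    \<Rightarrow> ((nat^'dx) \<times> (nat^'dv) \<Rightarrow> real) \<Rightarrow> (real^'dx \<Rightarrow> real) \<Rightarrow> real^'dx \<Rightarrow> real^'dx^'dx" where
  "AH_x X V \<beta> a R x = diag (\<lambda>l. interp X (nuH_x X V \<beta> a R l) x)"

definition AH_v :: "('dx::finite) fe \<Rightarrow> ('dv::finite) fe
    \<Rightarrow> ((real^'dx) \<times> (real^'dv) \<Rightarrow> (real^'dx) \<times> (real^'dv))
    \<Rightarrow> ((nat^'dx) \<times> (nat^'dv) \<Rightarrow> real) \<Rightarrow> (real^'dv \<Rightarrow> real) \<Rightarrow> real^'dv \<Rightarrow> real^'dv^'dv" where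
  "AH_v X V \<beta> a R v = diag (\<lambda>l. interp V (nuH_v X V \<beta> a R l) v)"

definition block_diag_mult :: "real^'dx^('dx::finite) \<Rightarrow> real^'dv^('dv::finite)
    \<Rightarrow> (real^'dx) \<times> (real^'dv) \<Rightarrow> (real^'dx) \<times> (real^'dv)" where
  "block_diag_mult P Q w = (P *v fst w, Q *v snd w)"

definition mass_mat :: "('dx::finite) fe \<Rightarrow> ('dv::finite) fe
    \<Rightarrow> (nat^'dx) \<times> (nat^'dv) \<Rightarrow> (nat^'dx) \<times> (nat^'dv) \<Rightarrow> real" where
  "mass_mat X V i j = l2ip (dom_box X \<times> dom_box V) (psi X V j) (psi X V i)"

definition conv_mat :: "('dx::finite) fe \<Rightarrow> ('dv::finite) fe
    \<Rightarrow> ((real^'dx) \<times> (real^'dv) \<Rightarrow> (real^'dx) \<times> (real^'dv))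
    \<Rightarrow> (nat^'dx) \<times> (nat^'dv) \<Rightarrow> (nat^'dx) \<times> (nat^'dv) \<Rightarrow> real" where
  "conv_mat X V \<beta> i j =
     l2ip (dom_box X \<times> dom_box V) (\<lambda>z. \<beta> z \<bullet> grad (psi X V j) z) (psi X V i)"

definition visc_mat :: "('dx::finite) fe \<Rightarrow> ('dv::finite) fe
    \<Rightarrow> (real^'dx \<Rightarrow> real^'dx^'dx) \<Rightarrow> (real^'dv \<Rightarrow> real^'dv^'dv)
    \<Rightarrow> (nat^'dx) \<times> (nat^'dv) \<Rightarrow> (nat^'dx) \<times> (nat^'dv) \<Rightarrow> real" where
  "visc_mat X V Ax Av i j = l2ip (dom_box X \<times> dom_box V)
     (\<lambda>z. block_diag_mult (Ax (fst z)) (Av (snd z)) (grad (psi X V j) z)) (grad (psi X V i))"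

text \<open>
  Time levels are integers: the coefficient vectors \<open>f (-1)\<close> and \<open>f (-2)\<close> are arbitrary starting
  data for the BDF2 formula in the first two steps.
\<close>

definition forward_euler_step :: "('dx::finite) fe \<Rightarrow> ('dv::finite) fe \<Rightarrow> (int \<Rightarrow> real)
    \<Rightarrow> ((real^'dx) \<times> (real^'dv) \<Rightarrow> (real^'dx) \<times> (real^'dv))
    \<Rightarrow> (real^'dx \<Rightarrow> real^'dx^'dx) \<Rightarrow> (real^'dv \<Rightarrow> real^'dv^'dv)
    \<Rightarrow> (int \<Rightarrow> (nat^'dx) \<times> (nat^'dv) \<Rightarrow> real) \<Rightarrow> int \<Rightarrow> bool" where
  "forward_euler_step X V t \<beta> Ax Av f n \<longleftrightarrow>
     (\<forall>i\<in>idx X \<times> idx V.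
        (\<Sum>j\<in>idx X \<times> idx V. mass_mat X V i j * ((f (n + 1) j - f n j) / (t (n + 1) - t n)))
        + (\<Sum>j\<in>idx X \<times> idx V. conv_mat X V \<beta> i j * f n j)
        + (\<Sum>j\<in>idx X \<times> idx V. visc_mat X V Ax Av i j * f n j) = 0)"

end

theory Submission
  imports Defs
begin

text \<open>
  The argument is the one that makes every finite element scheme with a divergence-free field
  conservative: test with the constant function \<open>1\<close>.  This is allowed because the shape functions
  form a partition of unity (\<open>shape_partition_of_unity\<close>), so that summing the equations of the
  scheme over \<open>i\<close> replaces every test function \<open>psi X V i\<close> by \<open>1\<close>.  The mass terms then become
  integrals of the basis functions.  The viscous terms vanish because they contain
  \<open>\<nabla> 1 = 0\<close> (\<open>sum_visc_mat\<close>), whatever the nodal values of the viscosity are.  What is left is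
  the convective term \<open>\<integral> \<beta> \<bullet> \<nabla> psi X V j\<close> (\<open>sum_conv_mat\<close>).
  
  That integral vanishes term by term.  The component of \<open>\<beta>\<close> along a coordinate axis never depends
  on that coordinate: \<open>\<beta>\<^sub>x = v\<close> does not depend on \<open>x\<close>, and the component \<open>m\<close> of \<open>E(x) + v \<times> B(x)\<close>
  does not contain \<open>v\<^sub>m\<close>.  Hence along each line in a coordinate direction the integrand is a
  constant times the derivative of a continuous periodic piecewise polynomial, whose integral over
  a period is zero by the fundamental theorem of calculus
  (\<open>has_integral_partial_along_line\<close>).  A function all of whose integrals along the lines of one
  direction vanish has integral zero (\<open>integral_eq_0_if_line_integrals_eq_0\<close>).  Since the factor \<open>\<beta>\<^sub>l\<close> is
  constant on these lines, it does no harm that \<open>\<beta>\<close> is not periodic in \<open>v\<close>.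
  
  The partition of unity holds because on one cell the sum of the shape functions is a polynomial of
  degree at most \<open>k\<close> in each variable that takes the value \<open>1\<close> on a tensor grid of \<open>k + 1\<close> points
  per direction.  Such a polynomial is constant (\<open>Qpoly_constant_if_constant_on_grid\<close>).
  
  Gradients are unspecified on the cell interfaces, and the fields are arbitrary there.  All
  integrals are therefore restricted to the union of the open cells, which differs from the domain by
  finitely many pieces of hyperplanes.  The integrands are continuous on each open cell with
  continuous extensions to the whole space, and this class of functions (\<open>piecewise_continuous\<close>)
  carries all integrability and measurability questions.
\<close>

section \<open>Polynomials of bounded degree in each variable\<close>

lemma finite_bounded_exponents: "finite {\<alpha> :: nat^('d::finite). \<forall>l. \<alpha> $ l \<le> k}"
proof -
  have "{\<alpha> :: nat^'d. \<forall>l. \<alpha> $ l \<le> k} \<subseteq> (\<lambda>h. \<chi> l. h l) ` (UNIV \<rightarrow>\<^sub>E {..k})"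
  proof
    fix \<alpha> :: "nat^'d" assume "\<alpha> \<in> {\<alpha>. \<forall>l. \<alpha> $ l \<le> k}"
    then have "(\<lambda>l. \<alpha> $ l) \<in> UNIV \<rightarrow>\<^sub>E {..k}" by auto
    then show "\<alpha> \<in> (\<lambda>h. \<chi> l. h l) ` (UNIV \<rightarrow>\<^sub>E {..k})" by (rule rev_image_eqI) simp
  qed
  then show ?thesis by (rule finite_subset) (intro finite_imageI finite_PiE; simp)
qed

lemma Qpoly_real_polynomial_function:
  assumes "p \<in> Qpoly k"
  shows "real_polynomial_function p"
proof -
  obtain a where p: "\<And>x. p x = (\<Sum>\<alpha> | \<forall>l. \<alpha> $ l \<le> k. a \<alpha> * (\<Prod>l\<in>UNIV. (x $ l) ^ (\<alpha> $ l)))"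
    using assms unfolding Qpoly_def by blast
  have "real_polynomial_function (\<lambda>x::real^'a. a \<alpha> * (\<Prod>l\<in>UNIV. (x $ l) ^ (\<alpha> $ l)))" for \<alpha>
    by (intro real_polynomial_function.intros(4) real_polynomial_function.intros(2)
        real_polynomial_function_prod real_polynomial_function_power
        real_polynomial_function.intros(1) bounded_linear_vec_nth) auto
  then have "real_polynomial_function (\<lambda>x. \<Sum>\<alpha> | \<forall>l. \<alpha> $ l \<le> k. a \<alpha> * (\<Prod>l\<in>UNIV. (x $ l) ^ (\<alpha> $ l)))"
    using finite_bounded_exponents by (intro real_polynomial_function_sum) auto
  then show ?thesis using p by presburger
qed

text \<open>
  The directional derivative is again continuous in the base point; this is what makes partial
  derivatives of finite element functions bounded and measurable on each cell.
\<close>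

lemma real_polynomial_function_line_derivative:
  assumes "real_polynomial_function p"
  shows "\<exists>q. continuous_on UNIV q \<and>
    (\<forall>x. ((\<lambda>s. p (x + s *\<^sub>R e)) has_real_derivative q x) (at 0))"
  using assms
proof induction
  case (linear f)
  then interpret bounded_linear f .
  have "((\<lambda>s. f (x + s *\<^sub>R e)) has_real_derivative f e) (at 0)" for x
    unfolding add scaleR by (auto intro!: derivative_eq_intros)
  then show ?case by (intro exI[of _ "\<lambda>_. f e"]) auto
next
  case (const c)
  show ?case by (intro exI[of _ "\<lambda>_. 0"]) auto
next
  case (add f g)
  then obtain f' g' where "continuous_on UNIV f'" "continuous_on UNIV g'"
    and *: "\<And>x. ((\<lambda>s. f (x + s *\<^sub>R e)) has_real_derivative f' x) (at 0)"
      "\<And>x. ((\<lambda>s. g (x + s *\<^sub>R e)) has_real_derivative g' x) (at 0)" by blast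
  then show ?case
    by (intro exI[of _ "\<lambda>x. f' x + g' x"]) (auto intro!: derivative_intros continuous_intros *)
next
  case (mult f g)
  then obtain f' g' where c: "continuous_on UNIV f'" "continuous_on UNIV g'"
    and *: "\<And>x. ((\<lambda>s. f (x + s *\<^sub>R e)) has_real_derivative f' x) (at 0)"
      "\<And>x. ((\<lambda>s. g (x + s *\<^sub>R e)) has_real_derivative g' x) (at 0)" by blast
  have "((\<lambda>s. f (x + s *\<^sub>R e) * g (x + s *\<^sub>R e)) has_real_derivative f' x * g x + g' x * f x) (at 0)" for x
    using DERIV_mult[OF *[of x]] by simp
  moreover have "continuous_on UNIV f" "continuous_on UNIV g"
    using mult.hyps by (auto simp: real_polynomial_function_eq intro: continuous_on_polymonial_function)
  ultimately show ?case using c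
    by (intro exI[of _ "\<lambda>x. f' x * g x + g' x * f x"]) (auto intro!: continuous_intros)
qed

lemma Qpoly_sum:
  assumes "\<And>i. i \<in> I \<Longrightarrow> p i \<in> Qpoly k"
  shows "(\<lambda>x. \<Sum>i\<in>I. p i x) \<in> Qpoly k"
proof -
  obtain a where a: "p i x = (\<Sum>\<alpha> | \<forall>l. \<alpha> $ l \<le> k. a i \<alpha> * (\<Prod>l\<in>UNIV. (x $ l) ^ (\<alpha> $ l)))"
    if "i \<in> I" for i x
    using bchoice[of I "\<lambda>i a. \<forall>x. p i x = (\<Sum>\<alpha> | \<forall>l. \<alpha> $ l \<le> k. a \<alpha> * (\<Prod>l\<in>UNIV. (x $ l) ^ (\<alpha> $ l)))"]
      assms unfolding Qpoly_def by blast
  have "(\<Sum>i\<in>I. p i x) = (\<Sum>\<alpha> | \<forall>l. \<alpha> $ l \<le> k. (\<Sum>i\<in>I. a i \<alpha>) * (\<Prod>l\<in>UNIV. (x $ l) ^ (\<alpha> $ l)))" for x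
    by (simp add: a sum_distrib_right) (rule sum.swap)
  then show ?thesis unfolding Qpoly_def by (intro CollectI exI allI)
qed

text \<open>
  In one variable, with the others frozen, an element of \<open>Qpoly k\<close> is an ordinary polynomial of
  degree at most \<open>k\<close>.  This reduces the identity theorem below to the univariate one.
\<close>

lemma Qpoly_restrict_coordinate:
  assumes "p \<in> Qpoly k"
  shows "\<exists>q::real poly. degree q \<le> k \<and> (\<forall>s. p (\<chi> l. if l = m then s else x $ l) = poly q s)"
proof -
  obtain a where p: "\<And>x. p x = (\<Sum>\<alpha> | \<forall>l. \<alpha> $ l \<le> k. a \<alpha> * (\<Prod>l\<in>UNIV. (x $ l) ^ (\<alpha> $ l)))"
    using assms unfolding Qpoly_def by blast
  define q where "q = (\<Sum>\<alpha> | \<forall>l. \<alpha> $ l \<le> k.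
    monom (a \<alpha> * (\<Prod>l\<in>UNIV - {m}. (x $ l) ^ (\<alpha> $ l))) (\<alpha> $ m))"
  have "degree q \<le> k"
    unfolding q_def using finite_bounded_exponents
    by (intro degree_sum_le) (auto intro: order_trans[OF degree_monom_le])
  moreover have "p (\<chi> l. if l = m then s else x $ l) = poly q s" for s
    unfolding p q_def poly_sum poly_monom
  proof (intro sum.cong refl)
    fix \<alpha> :: "nat^'a"
    have "(\<Prod>l\<in>UNIV. (\<chi> l. if l = m then s else x $ l) $ l ^ (\<alpha> $ l))
        = s ^ (\<alpha> $ m) * (\<Prod>l\<in>UNIV - {m}. (x $ l) ^ (\<alpha> $ l))"
      by (subst prod.remove[of _ m]) auto
    then show "a \<alpha> * (\<Prod>l\<in>UNIV. (\<chi> l. if l = m then s else x $ l) $ l ^ (\<alpha> $ l))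
        = a \<alpha> * (\<Prod>l\<in>UNIV - {m}. (x $ l) ^ (\<alpha> $ l)) * s ^ (\<alpha> $ m)" by simp
  qed
  ultimately show ?thesis by blast
qed

text \<open>
  The coordinates are released one after the other: when the coordinate \<open>m\<close> is released, the
  polynomial in that variable takes the value \<open>c\<close> at the more than \<open>k\<close> points of \<open>A m\<close>, hence
  everywhere.
\<close>

lemma Qpoly_constant_if_constant_on_grid:
  fixes p :: "real^('d::finite) \<Rightarrow> real"
  assumes p: "p \<in> Qpoly k" and card: "\<And>l. card (A l) > k"
    and const: "\<And>x. (\<And>l. x $ l \<in> A l) \<Longrightarrow> p x = c"
  shows "p x = c"
proof -
  \<comment> \<open>\<open>W\<close> is the set of the coordinates that are already released.\<close>
  have "\<forall>x. (\<forall>l\<in>UNIV - W. x $ l \<in> A l) \<longrightarrow> p x = c" if "finite W" for W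
    using that
  proof induction
    case empty
    then show ?case using const by auto
  next
    case (insert m W)
    show ?case
    proof (intro allI impI)
      fix x :: "real^'d" assume x: "\<forall>l\<in>UNIV - insert m W. x $ l \<in> A l"
      obtain q where q: "degree q \<le> k" "\<And>s. p (\<chi> l. if l = m then s else x $ l) = poly q s"
        using Qpoly_restrict_coordinate[OF p] by metis
      have "poly q s = poly [:c:] s" if "s \<in> A m" for s
      proof -
        have "p (\<chi> l. if l = m then s else x $ l) = c"
          using insert.IH x that by (auto simp del: vec_lambda_eta)
        then show ?thesis using q by simp
      qed
      then have "q = [:c:]" by (rule poly_eqI_degree[where A = "A m"]) (use card[of m] q in auto)
      moreover have "(\<chi> l. if l = m then x $ m else x $ l) = x" by (simp add: vec_eq_iff)
      ultimately show "p x = c" using q(2)[of "x $ m"] by simp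
    qed
  qed
  from this[of UNIV] show ?thesis by simp
qed

section \<open>Vanishing integrals along lines\<close>

text \<open>
  Fubini's theorem with the coordinate of \<open>b\<close> integrated first.  It works in every Euclidean space,
  in particular in the product space \<open>(x, v)\<close>, so that one coordinate can be split off without
  treating \<open>x\<close> and \<open>v\<close> separately.
\<close>

lemma integral_eq_0_if_line_integrals_eq_0:
  fixes F :: "'a::euclidean_space \<Rightarrow> real"
  assumes b: "b \<in> Basis" and F: "integrable lborel F"
    and line: "\<And>x. (LINT s|lborel. F (x + s *\<^sub>R b)) = 0"
  shows "(LINT x|lborel. F x) = 0"
proof -
  interpret product_sigma_finite "\<lambda>_::'a. lborel :: real measure" ..
  define G where "G h = F (\<Sum>b\<in>Basis. h b *\<^sub>R b)" for h
  have ins: "insert b (Basis - {b}) = (Basis :: 'a set)" using b by auto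
  have Fm[measurable]: "F \<in> borel_measurable borel" using borel_measurable_integrable[OF F] by simp
  have m[measurable]: "(\<lambda>f. \<Sum>b\<in>Basis. f b *\<^sub>R b) \<in> (\<Pi>\<^sub>M b\<in>(Basis::'a set). lborel) \<rightarrow>\<^sub>M borel"
    by measurable
  have "integrable (\<Pi>\<^sub>M b\<in>(Basis::'a set). lborel) G"
    using F unfolding G_def by (subst (asm) lborel_eq) (subst (asm) integrable_distr_eq; simp)
  then have i: "integrable (\<Pi>\<^sub>M b\<in>insert b (Basis - {b}). lborel) G" using ins by simp
  have "(LINT x|lborel. F x) = integral\<^sup>L (\<Pi>\<^sub>M b\<in>insert b (Basis - {b}). lborel) G"
    unfolding ins unfolding G_def by (subst lborel_eq) (rule integral_distr; simp)
  also have "\<dots> = (LINT h|(\<Pi>\<^sub>M b\<in>Basis - {b}. lborel). LINT s|lborel. G (h(b := s)))"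
    by (rule product_integral_insert) (use i in auto)
  also have "\<dots> = (LINT h|(\<Pi>\<^sub>M b\<in>Basis - {b}. (lborel :: real measure)). 0)"
  proof (rule Bochner_Integration.integral_cong[OF refl])
    fix h
    have "G (h(b := s)) = F ((\<Sum>b\<in>Basis - {b}. h b *\<^sub>R b) + s *\<^sub>R b)" for s
      unfolding G_def using b by (subst sum.remove[OF _ b]) (auto simp: add.commute intro!: sum.cong arg_cong[where f=F])
    then show "(LINT s|lborel. G (h(b := s))) = 0" by (simp add: line)
  qed
  finally show ?thesis by simp
qed

text \<open>
  If the function is not Lebesgue integrable, then its Lebesgue integral is zero by convention, so
  the Henstock-Kurzweil integral given by the fundamental theorem of calculus decides both cases.
\<close>

lemma lborel_integral_eq_0_if_has_integral_0:
  fixes f :: "real \<Rightarrow> real"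
  assumes "(f has_integral 0) UNIV"
  shows "(LINT s|lborel. f s) = 0"
proof (cases "integrable lborel f")
  case True
  then show ?thesis using integral_lborel[OF True] integral_unique[OF assms] by simp
qed (rule not_integrable_integral_eq)

section \<open>Piecewise continuous functions\<close>

text \<open>
  Asking for an extension to the whole space, and not only for continuity on the pieces, gives
  boundedness on bounded pieces for free.  The values outside the pieces are left open because
  gradients and fields are unspecified on the cell interfaces.
\<close>

definition piecewise_continuous :: "'a::topological_space set set \<Rightarrow> ('a \<Rightarrow> real) \<Rightarrow> bool" where
  "piecewise_continuous P g \<longleftrightarrow> (\<forall>U\<in>P. \<exists>p. continuous_on UNIV p \<and> (\<forall>x\<in>U. g x = p x))"

lemma piecewise_continuousI:
  "(\<And>U. U \<in> P \<Longrightarrow> \<exists>p. continuous_on UNIV p \<and> (\<forall>x\<in>U. g x = p x)) \<Longrightarrow> piecewise_continuous P g"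
  by (simp add: piecewise_continuous_def)

lemma piecewise_continuousE:
  assumes "piecewise_continuous P g" "U \<in> P"
  obtains p where "continuous_on UNIV p" "\<And>x. x \<in> U \<Longrightarrow> g x = p x"
  using assms by (auto simp: piecewise_continuous_def)

lemma piecewise_continuous_if_continuous:
  "continuous_on UNIV g \<Longrightarrow> piecewise_continuous P g"
  by (auto simp: piecewise_continuous_def)

lemma piecewise_continuous_cong:
  assumes "piecewise_continuous P h" and "\<And>x. x \<in> \<Union>P \<Longrightarrow> g x = h x"
  shows "piecewise_continuous P g"
  using assms by (force simp: piecewise_continuous_def)

lemma piecewise_continuous_add:
  assumes "piecewise_continuous P g" "piecewise_continuous P h"
  shows "piecewise_continuous P (\<lambda>x. g x + h x)"
proof (rule piecewise_continuousI)
  fix U assume "U \<in> P"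
  then obtain p q where "continuous_on UNIV p" "continuous_on UNIV q"
    "\<And>x. x \<in> U \<Longrightarrow> g x = p x" "\<And>x. x \<in> U \<Longrightarrow> h x = q x"
    using assms by (metis piecewise_continuousE)
  then show "\<exists>p. continuous_on UNIV p \<and> (\<forall>x\<in>U. g x + h x = p x)"
    by (intro exI[of _ "\<lambda>x. p x + q x"]) (auto intro: continuous_on_add)
qed

lemma piecewise_continuous_mult:
  assumes "piecewise_continuous P g" "piecewise_continuous P h"
  shows "piecewise_continuous P (\<lambda>x. g x * h x)"
proof (rule piecewise_continuousI)
  fix U assume "U \<in> P"
  then obtain p q where "continuous_on UNIV p" "continuous_on UNIV q"
    "\<And>x. x \<in> U \<Longrightarrow> g x = p x" "\<And>x. x \<in> U \<Longrightarrow> h x = q x"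
    using assms by (metis piecewise_continuousE)
  then show "\<exists>p. continuous_on UNIV p \<and> (\<forall>x\<in>U. g x * h x = p x)"
    by (intro exI[of _ "\<lambda>x. p x * q x"]) (auto intro: continuous_on_mult)
qed

lemma piecewise_continuous_sum:
  "(\<And>i. i \<in> I \<Longrightarrow> piecewise_continuous P (g i)) \<Longrightarrow> piecewise_continuous P (\<lambda>x. \<Sum>i\<in>I. g i x)"
  by (induction I rule: infinite_finite_induct)
    (auto intro: piecewise_continuous_if_continuous piecewise_continuous_add)

lemma set_integrable_piecewise_continuous:
  fixes P :: "'a::euclidean_space set set"
  assumes "finite P" and P: "\<And>U. U \<in> P \<Longrightarrow> open U \<and> bounded U"
    and g: "piecewise_continuous P g"
  shows "set_integrable lborel (\<Union>P) g"
proof -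
  have "set_integrable lborel U g" if U: "U \<in> P" for U
  proof -
    obtain p where p: "continuous_on UNIV p" "\<And>x. x \<in> U \<Longrightarrow> g x = p x"
      using piecewise_continuousE[OF g U] by blast
    have "set_integrable lborel (closure U) p"
      unfolding set_integrable_def using P[OF U] p(1)
      by (intro borel_integrable_compact) (auto intro: continuous_on_subset simp: compact_closure)
    then have "set_integrable lborel U p"
      by (rule set_integrable_subset) (use P[OF U] closure_subset in auto)
    then show ?thesis
      by (rule set_integrable_cong[THEN iffD1, rotated -1]) (simp_all add: p)
  qed
  then have "set_integrable lborel (\<Union>U\<in>P. id U) g"
    using P by (intro set_integrable_UN \<open>finite P\<close>) auto
  then show ?thesis by simp
qed

text \<open>
  The integral over \<open>S\<close> is the one of the scheme.  Sums and congruences are handled with the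
  Henstock-Kurzweil integral, and the integral with respect to the Borel measure is the one to which
  Fubini's theorem applies.
\<close>

lemma set_lebesgue_integral_piecewise_continuous:
  fixes P :: "'a::euclidean_space set set"
  assumes "finite P" and P: "\<And>U. U \<in> P \<Longrightarrow> open U \<and> bounded U"
    and sub: "\<Union>P \<subseteq> S" and negl: "negligible (S - \<Union>P)"
    and g: "piecewise_continuous P g"
  shows "g integrable_on \<Union>P" "(LINT x:S|lebesgue. g x) = integral (\<Union>P) g"
    "(LINT x:S|lebesgue. g x) = (LINT x:\<Union>P|lborel. g x)"
proof -
  have l: "set_integrable lborel (\<Union>P) g"
    by (rule set_integrable_piecewise_continuous) (use assms in auto)
  have D: "g absolutely_integrable_on \<Union>P"
    using l integrable_completion[of "\<lambda>x. indicator (\<Union>P) x *\<^sub>R g x" lborel]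
    by (auto simp: set_integrable_def)
  then show "g integrable_on \<Union>P" by (rule set_lebesgue_integral_eq_integral)
  have *: "negligible {x \<in> S - \<Union>P. g x \<noteq> 0}" "negligible {x \<in> \<Union>P - S. g x \<noteq> 0}"
    using negl sub by (auto intro: negligible_subset)
  have "g absolutely_integrable_on S"
    using D * by (subst absolutely_integrable_spike_set_eq) auto
  then have "(LINT x:S|lebesgue. g x) = integral S g" by (rule set_lebesgue_integral_eq_integral)
  also have "\<dots> = integral (\<Union>P) g" by (rule integral_spike_set) (use * in auto)
  finally show eq: "(LINT x:S|lebesgue. g x) = integral (\<Union>P) g" .
  have "integral (\<Union>P) g = (LINT x:\<Union>P|lebesgue. g x)"
    using set_lebesgue_integral_eq_integral(2)[OF D] by simp
  also have "\<dots> = (LINT x:\<Union>P|lborel. g x)"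
    unfolding set_lebesgue_integral_def by (rule integral_completion)
      (use l borel_measurable_integrable in \<open>auto simp: set_integrable_def\<close>)
  finally show "(LINT x:S|lebesgue. g x) = (LINT x:\<Union>P|lborel. g x)" using eq by simp
qed

definition product_mesh :: "'a set set \<Rightarrow> 'b set set \<Rightarrow> ('a \<times> 'b) set set" where
  "product_mesh P Q = (\<lambda>(A, B). A \<times> B) ` (P \<times> Q)"

lemma Union_product_mesh: "\<Union>(product_mesh P Q) = \<Union>P \<times> \<Union>Q"
  by (force simp: product_mesh_def)

lemma piecewise_continuous_fst:
  assumes "piecewise_continuous P g"
  shows "piecewise_continuous (product_mesh P Q) (\<lambda>z. g (fst z))"
proof (rule piecewise_continuousI)
  fix U assume "U \<in> product_mesh P Q"
  then obtain A where A: "A \<in> P" "fst ` U \<subseteq> A" by (auto simp: product_mesh_def)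
  then obtain p where "continuous_on UNIV p" "\<And>x. x \<in> A \<Longrightarrow> g x = p x"
    using piecewise_continuousE[OF assms] by metis
  then show "\<exists>p. continuous_on UNIV p \<and> (\<forall>z\<in>U. g (fst z) = p z)"
    using A(2) by (intro exI[of _ "\<lambda>z. p (fst z)"])
      (auto intro: continuous_on_compose2[OF _ continuous_on_fst[OF continuous_on_id]])
qed

lemma piecewise_continuous_snd:
  assumes "piecewise_continuous Q g"
  shows "piecewise_continuous (product_mesh P Q) (\<lambda>z. g (snd z))"
proof (rule piecewise_continuousI)
  fix U assume "U \<in> product_mesh P Q"
  then obtain A where A: "A \<in> Q" "snd ` U \<subseteq> A" by (auto simp: product_mesh_def)
  then obtain p where "continuous_on UNIV p" "\<And>x. x \<in> A \<Longrightarrow> g x = p x"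
    using piecewise_continuousE[OF assms] by metis
  then show "\<exists>p. continuous_on UNIV p \<and> (\<forall>z\<in>U. g (snd z) = p z)"
    using A(2) by (intro exI[of _ "\<lambda>z. p (snd z)"])
      (auto intro: continuous_on_compose2[OF _ continuous_on_snd[OF continuous_on_id]])
qed

section \<open>Cells of the mesh\<close>

definition mesh :: "('d::finite) fe \<Rightarrow> (real^'d) set set" where
  "mesh Z = (\<lambda>c. box (cell_lo Z c) (cell_hi Z c)) ` cells Z"

lemma finite_index_box: "finite {i :: nat^('d::finite). \<forall>l. i $ l < N l}"
proof (rule finite_subset)
  show "{i :: nat^'d. \<forall>l. i $ l < N l} \<subseteq> {i. \<forall>l. i $ l \<le> (\<Sum>l\<in>UNIV. N l)}"
  proof clarsimp
    fix i :: "nat^'d" and l assume "\<forall>l. i $ l < N l"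
    then have "i $ l \<le> N l" by (simp add: less_imp_le)
    also have "\<dots> \<le> (\<Sum>l\<in>UNIV. N l)" by (rule member_le_sum) auto
    finally show "i $ l \<le> (\<Sum>l\<in>UNIV. N l)" .
  qed
qed (rule finite_bounded_exponents)

lemma finite_idx: "finite (idx Z)"
  unfolding idx_def by (rule finite_index_box)

lemma finite_mesh: "finite (mesh Z)"
  unfolding mesh_def cells_def by (intro finite_imageI finite_index_box)

lemma open_bounded_mesh: "U \<in> mesh Z \<Longrightarrow> open U \<and> bounded U"
  by (auto simp: mesh_def open_box bounded_box)

text \<open>
  Membership in an open cell is a condition on each coordinate separately.  Hence a line in a
  coordinate direction either misses all open cells or, inside the box, leaves them only at grid points.
\<close>

lemma Union_mesh_iff:
  "x \<in> \<Union>(mesh Z) \<longleftrightarrow> (\<forall>l. \<exists>m<ncells Z $ l. corner Z $ l + msize Z $ l * real m < x $ l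
     \<and> x $ l < corner Z $ l + msize Z $ l * (real m + 1))" (is "_ \<longleftrightarrow> (\<forall>l. \<exists>m. ?P l m)")
proof
  assume "\<forall>l. \<exists>m. ?P l m"
  then obtain c where "\<And>l. ?P l (c l)" by metis
  then have "(\<chi> l. c l) \<in> cells Z" "x \<in> box (cell_lo Z (\<chi> l. c l)) (cell_hi Z (\<chi> l. c l))"
    by (simp_all add: cells_def mem_box_cart cell_lo_def cell_hi_def)
  then show "x \<in> \<Union>(mesh Z)" by (auto simp: mesh_def)
qed (auto simp: mesh_def cells_def mem_box_cart cell_lo_def cell_hi_def)

text \<open>
  The cell is found by rounding down the distance from the lower end, measured in cell lengths.
\<close>

lemma grid_interval_exists:
  fixes a h s :: real
  assumes h: "h > 0" and s: "a \<le> s" "s \<le> a + h * real N"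
    and off: "s \<notin> (\<lambda>m. a + h * real m) ` {..N}"
  shows "\<exists>m<N. a + h * real m < s \<and> s < a + h * (real m + 1)"
proof -
  define m where "m = nat \<lfloor>(s - a) / h\<rfloor>"
  have "0 \<le> (s - a) / h" using h s by simp
  then have m: "real m \<le> (s - a) / h" "(s - a) / h < real m + 1"
    unfolding m_def by linarith+
  then have 1: "a + h * real m \<le> s" "s < a + h * (real m + 1)"
    using h by (simp_all add: field_simps)
  have "h * real m \<le> h * real N" using 1 s by linarith
  then have "m \<le> N" using h by simp
  moreover have 2: "s \<noteq> a + h * real m'" if "m' \<le> N" for m' using off that by auto
  ultimately have "a + h * real m < s" using 1 by force
  moreover have "m \<noteq> N" using 1 2 s \<open>m \<le> N\<close> by force
  ultimately show ?thesis using 1 \<open>m \<le> N\<close> by (intro exI[of _ m]) auto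
qed

definition grid_points :: "('d::finite) fe \<Rightarrow> 'd \<Rightarrow> real set" where
  "grid_points Z l = (\<lambda>m. corner Z $ l + msize Z $ l * real m) ` {..ncells Z $ l}"

lemma Union_mesh_subset_dom_box:
  assumes "\<And>l. msize Z $ l > 0"
  shows "\<Union>(mesh Z) \<subseteq> dom_box Z"
proof
  fix x assume x: "x \<in> \<Union>(mesh Z)"
  have "corner Z $ l \<le> x $ l \<and> x $ l \<le> corner Z $ l + msize Z $ l * real (ncells Z $ l)" for l
  proof -
    obtain m where m: "m < ncells Z $ l" "corner Z $ l + msize Z $ l * real m < x $ l"
      "x $ l < corner Z $ l + msize Z $ l * (real m + 1)" using x unfolding Union_mesh_iff by blast
    have "real m + 1 \<le> real (ncells Z $ l)" using m(1) by linarith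
    then have "msize Z $ l * (real m + 1) \<le> msize Z $ l * real (ncells Z $ l)"
      using assms[of l] by simp
    moreover have "0 \<le> msize Z $ l * real m" using assms[of l] by simp
    ultimately show ?thesis using m by linarith
  qed
  then show "x \<in> dom_box Z" by (simp add: dom_box_def mem_box_cart)
qed

lemma dom_box_minus_mesh:
  assumes "\<And>l. msize Z $ l > 0"
  shows "dom_box Z - \<Union>(mesh Z) \<subseteq> (\<Union>l. \<Union>g\<in>grid_points Z l. {x. x $ l = g})"
proof clarsimp
  fix x assume x: "x \<in> dom_box Z" "\<forall>U\<in>mesh Z. x \<notin> U"
  then obtain l where l: "\<not> (\<exists>m<ncells Z $ l. corner Z $ l + msize Z $ l * real m < x $ l
     \<and> x $ l < corner Z $ l + msize Z $ l * (real m + 1))" using Union_mesh_iff[of x Z] by auto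
  have "x $ l \<in> grid_points Z l"
    using l grid_interval_exists[of "msize Z $ l" "corner Z $ l" "x $ l" "ncells Z $ l"] assms x(1)
    by (auto simp: dom_box_def mem_box_cart grid_points_def)
  then show "\<exists>l. x $ l \<in> grid_points Z l" by blast
qed

lemma finite_grid_points: "finite (grid_points Z l)"
  by (simp add: grid_points_def)

lemma negligible_product_mesh_complement:
  fixes X :: "('dx::finite) fe" and V :: "('dv::finite) fe"
  assumes "\<And>l. msize X $ l > 0" "\<And>l. msize V $ l > 0"
  shows "negligible (dom_box X \<times> dom_box V - \<Union>(product_mesh (mesh X) (mesh V)))"
proof (rule negligible_subset)
  have "negligible {z :: (real^'dx) \<times> (real^'dv). fst z $ l = g}" for l g
    using negligible_standard_hyperplane[of "(axis l 1, 0) :: (real^'dx) \<times> (real^'dv)" g]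
    by (simp add: Basis_prod_def inner_prod_def inner_axis axis_in_Basis_iff)
  moreover have "negligible {z :: (real^'dx) \<times> (real^'dv). snd z $ l = g}" for l g
    using negligible_standard_hyperplane[of "(0, axis l 1) :: (real^'dx) \<times> (real^'dv)" g]
    by (simp add: Basis_prod_def inner_prod_def inner_axis axis_in_Basis_iff)
  ultimately show "negligible ((\<Union>l. \<Union>g\<in>grid_points X l. {z :: (real^'dx) \<times> (real^'dv). fst z $ l = g})
      \<union> (\<Union>l. \<Union>g\<in>grid_points V l. {z. snd z $ l = g}))"
    by (intro negligible_Un negligible_Union) (auto intro!: negligible_Union finite_grid_points)
  show "dom_box X \<times> dom_box V - \<Union>(product_mesh (mesh X) (mesh V))
    \<subseteq> (\<Union>l. \<Union>g\<in>grid_points X l. {z :: (real^'dx) \<times> (real^'dv). fst z $ l = g})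
      \<union> (\<Union>l. \<Union>g\<in>grid_points V l. {z. snd z $ l = g})"
    (is "_ \<subseteq> ?R")
  proof
    fix z assume "z \<in> dom_box X \<times> dom_box V - \<Union>(product_mesh (mesh X) (mesh V))"
    then consider "fst z \<in> dom_box X - \<Union>(mesh X)" | "snd z \<in> dom_box V - \<Union>(mesh V)"
      unfolding Union_product_mesh by (metis DiffD1 DiffD2 DiffI mem_Times_iff)
    then show "z \<in> ?R"
    proof cases
      case 1
      then have "fst z \<in> (\<Union>l. \<Union>g\<in>grid_points X l. {x. x $ l = g})"
        using dom_box_minus_mesh[of X, OF assms(1)] by (rule rev_subsetD)
      then show ?thesis by auto
    next
      case 2
      then have "snd z \<in> (\<Union>l. \<Union>g\<in>grid_points V l. {x. x $ l = g})"
        using dom_box_minus_mesh[of V, OF assms(2)] by (rule rev_subsetD)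
      then show ?thesis by auto
    qed
  qed
qed

lemma fe_space_derivative_on_cell:
  assumes u: "u \<in> fe_space Z" and U: "U \<in> mesh Z"
  shows "\<exists>q. continuous_on UNIV q \<and>
    (\<forall>x\<in>U. ((\<lambda>s. u (x + s *\<^sub>R axis l 1)) has_real_derivative q x) (at 0))"
proof -
  obtain c where c: "c \<in> cells Z" "U = box (cell_lo Z c) (cell_hi Z c)"
    using U by (auto simp: mesh_def)
  then obtain p where p: "p \<in> Qpoly (degr Z)" "\<And>x. x \<in> U \<Longrightarrow> u x = p x"
    using u box_subset_cbox unfolding fe_space_def by blast
  obtain q where q: "continuous_on UNIV q"
    "\<And>x. ((\<lambda>s. p (x + s *\<^sub>R axis l 1)) has_real_derivative q x) (at 0)"
    using real_polynomial_function_line_derivative[OF Qpoly_real_polynomial_function[OF p(1)]] by metis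
  have "((\<lambda>s. u (x + s *\<^sub>R axis l 1)) has_real_derivative q x) (at 0)" if "x \<in> U" for x
  proof (rule has_field_derivative_transform_within_open[OF q(2)])
    have "open U" using c(2) by (simp add: open_box)
    then show "open ((\<lambda>s. x + s *\<^sub>R axis l 1) -` U)"
      by (intro continuous_open_vimage) (auto intro!: continuous_intros)
  qed (use that p in auto)
  with q(1) show ?thesis by blast
qed

lemma fe_space_has_partial:
  assumes "u \<in> fe_space Z" and "x \<in> \<Union>(mesh Z)"
  shows "((\<lambda>s. u (x + s *\<^sub>R axis l 1)) has_real_derivative partial l u x) (at 0)"
proof -
  obtain U where U: "U \<in> mesh Z" "x \<in> U" using assms(2) by blast
  then obtain D where "((\<lambda>s. u (x + s *\<^sub>R axis l 1)) has_real_derivative D) (at 0)"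
    using fe_space_derivative_on_cell[OF assms(1) U(1)] by blast
  then show ?thesis unfolding partial_def by (simp add: DERIV_imp_deriv)
qed

lemma piecewise_continuous_partial:
  assumes "u \<in> fe_space Z"
  shows "piecewise_continuous (mesh Z) (partial l u)"
proof (rule piecewise_continuousI)
  fix U assume "U \<in> mesh Z"
  from fe_space_derivative_on_cell[OF assms this, of l]
  show "\<exists>p. continuous_on UNIV p \<and> (\<forall>x\<in>U. partial l u x = p x)"
    unfolding partial_def by (metis DERIV_imp_deriv)
qed

lemma piecewise_continuous_fe_space:
  "u \<in> fe_space Z \<Longrightarrow> piecewise_continuous P u"
  by (rule piecewise_continuous_if_continuous) (simp add: fe_space_def)

section \<open>Periodic finite element functions\<close>

text \<open>
  The function is continuous along the line and differentiable off the finitely many grid points, so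
  the integral over one period is the difference of two values that agree by periodicity.  The line is
  cut at the interfaces; a line that lies inside an interface contributes nothing because of the
  indicator function.
\<close>

lemma has_integral_partial_along_line:
  assumes h: "\<And>l. msize Z $ l > 0" and u: "u \<in> fe_space Z"
  shows "((\<lambda>s. indicator (\<Union>(mesh Z)) (x + s *\<^sub>R axis l 1) * partial l u (x + s *\<^sub>R axis l 1))
    has_integral 0) UNIV"
proof (cases "\<exists>s. x + s *\<^sub>R axis l 1 \<in> \<Union>(mesh Z)")
  case False
  then show ?thesis by (simp add: indicator_def)
next
  case True
  let ?y = "\<lambda>s. x + s *\<^sub>R axis l 1"
  have y: "?y s $ l' = (if l' = l then x $ l + s else x $ l')" for s l'
    by (simp add: axis_def)
  obtain s0 where s0: "?y s0 \<in> \<Union>(mesh Z)" using True by blast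
  \<comment> \<open>The line is inside the box for parameters between \<open>a\<close> and \<open>b\<close>; it meets interfaces at the parameters in \<open>S\<close>.\<close>
  define a where "a = corner Z $ l - x $ l"
  define b where "b = a + msize Z $ l * real (ncells Z $ l)"
  define S where "S = (\<lambda>g. g - x $ l) ` grid_points Z l"
  have fin: "finite S" using finite_grid_points unfolding S_def by blast
  have ab: "a \<le> b" using h[of l] unfolding b_def by simp
  have regular: "?y s \<in> \<Union>(mesh Z)" if s: "s \<in> {a<..<b} - S" for s
    unfolding Union_mesh_iff
  proof
    fix l'
    show "\<exists>m<ncells Z $ l'. corner Z $ l' + msize Z $ l' * real m < ?y s $ l'
        \<and> ?y s $ l' < corner Z $ l' + msize Z $ l' * (real m + 1)"
    proof (cases "l' = l")
      case True
      have "x $ l + s \<notin> grid_points Z l" using s unfolding S_def by force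
      then show ?thesis
        using True s grid_interval_exists[OF h, of "corner Z $ l" "x $ l + s" l "ncells Z $ l"]
        unfolding y by (simp add: grid_points_def a_def b_def)
    next
      case False
      then show ?thesis using s0[unfolded Union_mesh_iff, rule_format, of l'] unfolding y by simp
    qed
  qed
  have der: "((\<lambda>s. u (?y s)) has_vector_derivative partial l u (?y s)) (at s)"
    if "s \<in> {a<..<b} - S" for s
  proof -
    have "((\<lambda>r. u (?y s + r *\<^sub>R axis l 1)) has_real_derivative partial l u (?y s)) (at 0)"
      by (rule fe_space_has_partial[OF u regular[OF that]])
    then have "((\<lambda>r. u (?y (r + s))) has_real_derivative partial l u (?y s)) (at 0)"
      by (simp add: algebra_simps)
    then show ?thesis
      using DERIV_shift[of "\<lambda>s. u (?y s)" _ 0 s] by (simp add: has_real_derivative_iff_has_vector_derivative)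
  qed
  have "continuous_on {a..b} (\<lambda>s. u (?y s))"
    using u unfolding fe_space_def
    by (auto intro!: continuous_on_compose2[of UNIV u] continuous_intros)
  then have "((\<lambda>s. partial l u (?y s)) has_integral u (?y b) - u (?y a)) {a..b}"
    using fundamental_theorem_of_calculus_interior_strong[OF fin ab der] by blast
  moreover have "u (?y b) = u (?y a)"
  proof -
    have "?y b = ?y a + (msize Z $ l * real (ncells Z $ l)) *\<^sub>R axis l 1"
      by (simp add: b_def algebra_simps)
    then show ?thesis using u unfolding fe_space_def by (metis (mono_tags, lifting) mem_Collect_eq)
  qed
  ultimately have "((\<lambda>s. partial l u (?y s)) has_integral 0) {a..b}" by simp
  then have "((\<lambda>s. indicator (\<Union>(mesh Z)) (?y s) * partial l u (?y s)) has_integral 0) {a..b}"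
    by (rule has_integral_spike_finite[of "S \<union> {a, b}", rotated 2]) (use fin regular in auto)
  then show ?thesis
  proof (rule has_integral_on_superset)
    fix s assume "s \<notin> {a..b}"
    then have "?y s \<notin> dom_box Z"
      unfolding dom_box_def mem_box_cart y by (auto simp: a_def b_def intro!: exI[of _ l])
    then have "?y s \<notin> \<Union>(mesh Z)" using Union_mesh_subset_dom_box[OF h] by blast
    then show "indicator (\<Union>(mesh Z)) (?y s) * partial l u (?y s) = 0" by (simp add: indicator_def)
  qed auto
qed

lemma fe_space_periodic_sum:
  assumes u: "u \<in> fe_space Z" and "finite W"
  shows "u (x + (\<Sum>l\<in>W. (msize Z $ l * real (ncells Z $ l)) *\<^sub>R axis l 1)) = u x"
  using \<open>finite W\<close>
proof (induction W)
  case (insert l W)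
  let ?e = "\<lambda>l. (msize Z $ l * real (ncells Z $ l)) *\<^sub>R axis l (1::real)"
  have "u (x + (\<Sum>l\<in>insert l W. ?e l)) = u ((x + (\<Sum>l\<in>W. ?e l)) + ?e l)"
    using insert.hyps by (simp add: algebra_simps)
  also have "\<dots> = u (x + (\<Sum>l\<in>W. ?e l))" using u unfolding fe_space_def by blast
  finally show ?case using insert.IH by simp
qed simp

text \<open>
  Only the nodes of the box without its upper faces are indexed.  A node of a closed cell may lie on an
  upper face of the box in the directions \<open>W\<close>; it is the copy of an indexed node, shifted by one
  period in each of these directions.
\<close>

lemma sum_shape_at_cell_node:
  fixes Z :: "('d::finite) fe"
  assumes Z: "lagrange_fe Z" and c: "c \<in> cells Z" and \<alpha>: "\<And>l. \<alpha> l \<le> degr Z"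
    and y: "\<And>l. y $ l = corner Z $ l + msize Z $ l * (real (c $ l) + refnode Z (\<alpha> l))"
  shows "(\<Sum>i\<in>idx Z. shape Z i y) = 1"
proof -
  let ?k = "degr Z"
  have k: "?k \<ge> 1" "refnode Z 0 = 0" "refnode Z ?k = 1"
    and shape: "\<And>i j. i \<in> idx Z \<Longrightarrow> j \<in> idx Z \<Longrightarrow> shape Z i (node Z j) = (if i = j then 1 else 0)"
    and fe: "\<And>i. i \<in> idx Z \<Longrightarrow> shape Z i \<in> fe_space Z"
    using Z unfolding lagrange_fe_def by auto
  define W where "W = {l. \<alpha> l = ?k \<and> c $ l + 1 = ncells Z $ l}"
  \<comment> \<open>A last reference node of a cell is the first one of the next cell: then \<open>\<alpha> l = k\<close> carries over into the quotient by \<open>k\<close>.\<close>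
  define j where "j = (\<chi> l. if l \<in> W then 0 else c $ l * ?k + \<alpha> l)"
  have cl: "c $ l < ncells Z $ l" for l using c by (simp add: cells_def)
  have "j $ l < ncells Z $ l * ?k" for l
  proof -
    consider "l \<in> W" | "l \<notin> W" "\<alpha> l = ?k" | "l \<notin> W" "\<alpha> l < ?k" using \<alpha>[of l] by linarith
    then show ?thesis
    proof cases
      case 1
      then show ?thesis using k cl[of l] by (simp add: j_def)
    next
      case 2
      then have "c $ l + 1 < ncells Z $ l" using cl[of l] by (simp add: W_def)
      then have "(c $ l + 1) * ?k < ncells Z $ l * ?k" using k(1) by (intro mult_strict_right_mono) auto
      then show ?thesis using 2 by (simp add: j_def)
    next
      case 3
      then have "j $ l < (c $ l + 1) * ?k" by (simp add: j_def)
      also have "\<dots> \<le> ncells Z $ l * ?k" using cl[of l] by (intro mult_le_mono1) simp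
      finally show ?thesis .
    qed
  qed
  then have j: "j \<in> idx Z" by (simp add: idx_def)
  have "y = node Z j + (\<Sum>l\<in>W. (msize Z $ l * real (ncells Z $ l)) *\<^sub>R axis l 1)"
  proof (subst vec_eq_iff, rule allI)
    fix l
    have "(\<Sum>m\<in>W. (msize Z $ m * real (ncells Z $ m)) *\<^sub>R axis m 1 :: real^'d) $ l
        = (if l \<in> W then msize Z $ l * real (ncells Z $ l) else 0)"
      by (auto simp: axis_def if_distrib cong: if_cong)
    moreover have "y $ l = node Z j $ l + (if l \<in> W then msize Z $ l * real (ncells Z $ l) else 0)"
    proof (cases "l \<in> W")
      case True
      then have "real (ncells Z $ l) = real (c $ l) + 1" "\<alpha> l = ?k" by (simp_all add: W_def)
      then show ?thesis using True k by (simp add: y node_def j_def)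
    next
      case False
      have "real (j $ l div ?k) + refnode Z (j $ l mod ?k) = real (c $ l) + refnode Z (\<alpha> l)"
      proof (cases "\<alpha> l = ?k")
        case True
        then have "j $ l = (c $ l + 1) * ?k" using False by (simp add: j_def)
        then have "j $ l div ?k = c $ l + 1" "j $ l mod ?k = 0" using k(1) by simp_all
        then show ?thesis using True k by simp
      next
        case False2: False
        then have "\<alpha> l < ?k" using \<alpha>[of l] by simp
        then show ?thesis using False by (simp add: j_def)
      qed
      then show ?thesis using False by (simp add: y node_def)
    qed
    ultimately show "y $ l = (node Z j + (\<Sum>l\<in>W. (msize Z $ l * real (ncells Z $ l)) *\<^sub>R axis l 1)) $ l"
      by simp
  qed
  then have "(\<Sum>i\<in>idx Z. shape Z i y) = (\<Sum>i\<in>idx Z. shape Z i (node Z j))"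
    using fe by (intro sum.cong) (auto simp: fe_space_periodic_sum)
  also have "\<dots> = (\<Sum>i\<in>idx Z. if i = j then 1 else 0)" using j shape by (intro sum.cong) auto
  also have "\<dots> = 1" using j finite_idx[of Z] by simp
  finally show ?thesis .
qed

lemma shape_partition_of_unity:
  fixes Z :: "('d::finite) fe"
  assumes Z: "lagrange_fe Z" and x: "x \<in> \<Union>(mesh Z)"
  shows "(\<Sum>i\<in>idx Z. shape Z i x) = 1"
proof -
  let ?k = "degr Z"
  have h: "\<And>l. msize Z $ l > 0" and k: "refnode Z 0 = 0" "refnode Z ?k = 1"
    and mono: "strict_mono_on {..?k} (refnode Z)"
    and fe: "\<And>i. i \<in> idx Z \<Longrightarrow> shape Z i \<in> fe_space Z"
    using Z unfolding lagrange_fe_def by auto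
  obtain c where c: "c \<in> cells Z" "x \<in> box (cell_lo Z c) (cell_hi Z c)"
    using x by (auto simp: mesh_def)
  have "\<forall>i\<in>idx Z. \<exists>p\<in>Qpoly ?k. \<forall>x\<in>cbox (cell_lo Z c) (cell_hi Z c). shape Z i x = p x"
    using fe c(1) unfolding fe_space_def by blast
  then obtain p where p: "\<And>i. i \<in> idx Z \<Longrightarrow> p i \<in> Qpoly ?k"
    "\<And>i x. i \<in> idx Z \<Longrightarrow> x \<in> cbox (cell_lo Z c) (cell_hi Z c) \<Longrightarrow> shape Z i x = p i x"
    by (metis (no_types, lifting))
  define A where "A l = (\<lambda>m. corner Z $ l + msize Z $ l * (real (c $ l) + refnode Z m)) ` {..?k}" for l
  have "(\<Sum>i\<in>idx Z. p i x) = 1"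
  proof (rule Qpoly_constant_if_constant_on_grid[where A = A])
    show "(\<lambda>x. \<Sum>i\<in>idx Z. p i x) \<in> Qpoly ?k" using p(1) by (rule Qpoly_sum)
    show "?k < card (A l)" for l
    proof -
      have "inj_on (refnode Z) {..?k}" using mono by (rule strict_mono_on_imp_inj_on)
      then have "inj_on (\<lambda>m. corner Z $ l + msize Z $ l * (real (c $ l) + refnode Z m)) {..?k}"
        using h[of l] by (auto simp: inj_on_def)
      then show ?thesis unfolding A_def by (simp add: card_image)
    qed
    fix y :: "real^'d" assume "\<And>l. y $ l \<in> A l"
    then have "\<forall>l. \<exists>m\<le>?k. y $ l = corner Z $ l + msize Z $ l * (real (c $ l) + refnode Z m)"
      by (auto simp: A_def)
    then obtain \<alpha> where \<alpha>: "\<And>l. \<alpha> l \<le> ?k"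
      "\<And>l. y $ l = corner Z $ l + msize Z $ l * (real (c $ l) + refnode Z (\<alpha> l))" by metis
    have "0 \<le> refnode Z (\<alpha> l) \<and> refnode Z (\<alpha> l) \<le> 1" for l
      using strict_mono_on_leD[OF mono, of 0 "\<alpha> l"] strict_mono_on_leD[OF mono, of "\<alpha> l" ?k]
        \<alpha>(1)[of l] k by simp
    then have "y \<in> cbox (cell_lo Z c) (cell_hi Z c)"
      using h by (simp add: mem_box_cart cell_lo_def cell_hi_def \<alpha>(2) less_imp_le)
    then have "(\<Sum>i\<in>idx Z. p i y) = (\<Sum>i\<in>idx Z. shape Z i y)" using p(2) by simp
    then show "(\<Sum>i\<in>idx Z. p i y) = 1"
      using sum_shape_at_cell_node[OF Z c(1) \<alpha>] by simp
  qed
  moreover have "x \<in> cbox (cell_lo Z c) (cell_hi Z c)" using c(2) box_subset_cbox by blast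
  ultimately show ?thesis using p(2) by simp
qed

text \<open>
  The cells are open, so the sum of the shape functions is \<open>1\<close> in a neighbourhood and not only at
  the point.
\<close>

lemma sum_partial_shape_eq_0:
  assumes Z: "lagrange_fe Z" and x: "x \<in> \<Union>(mesh Z)"
  shows "(\<Sum>i\<in>idx Z. partial l (shape Z i) x) = 0"
proof -
  have "((\<lambda>s. shape Z i (x + s *\<^sub>R axis l 1)) has_real_derivative partial l (shape Z i) x) (at 0)"
    if "i \<in> idx Z" for i
    using that Z x by (intro fe_space_has_partial) (auto simp: lagrange_fe_def)
  then have 1: "((\<lambda>s. \<Sum>i\<in>idx Z. shape Z i (x + s *\<^sub>R axis l 1)) has_real_derivative
      (\<Sum>i\<in>idx Z. partial l (shape Z i) x)) (at 0)"
    by (rule DERIV_sum)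
  obtain U where U: "U \<in> mesh Z" "x \<in> U" using x by blast
  have "((\<lambda>s. \<Sum>i\<in>idx Z. shape Z i (x + s *\<^sub>R axis l 1)) has_real_derivative 0) (at 0)"
  proof (rule has_field_derivative_transform_within_open[of "\<lambda>_. 1"])
    show "open ((\<lambda>s. x + s *\<^sub>R axis l 1) -` U)"
      using open_bounded_mesh[OF U(1)] by (intro continuous_open_vimage) (auto intro!: continuous_intros)
    show "1 = (\<Sum>i\<in>idx Z. shape Z i (x + s *\<^sub>R axis l 1))" if "s \<in> (\<lambda>s. x + s *\<^sub>R axis l 1) -` U" for s
      using shape_partition_of_unity[OF Z] that U(1) by (metis UnionI vimageD)
  qed (use U in auto)
  with 1 show ?thesis by (rule DERIV_unique)
qed

lemma continuous_on_interp:
  assumes "lagrange_fe Z"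
  shows "continuous_on UNIV (interp Z a)"
  using assms unfolding interp_def lagrange_fe_def fe_space_def
  by (intro continuous_intros) auto

section \<open>Algebra of the advection field and of the viscosity\<close>

text \<open>
  Together with \<open>vel3_shift\<close> this says that the component of the magnetic force along a retained
  velocity direction does not change when that velocity component does.
\<close>

lemma cross3_component_cong:
  assumes "\<And>n. n \<noteq> m \<Longrightarrow> a $ n = a' $ n"
  shows "cross3 a b $ m = cross3 a' b $ m"
  using exhaust_3[of m] assms[of 1] assms[of 2] assms[of 3] by (auto simp: cross3_def)

lemma vel3_shift:
  assumes "m \<noteq> cv l"
  shows "vel3 cv (v + s *\<^sub>R axis l 1) $ m = vel3 cv v $ m"
  using assms by (auto simp: vel3_def axis_def intro!: sum.cong)

lemma continuous_on_vel3: "continuous_on UNIV (\<lambda>v. vel3 cv v $ m)"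
  by (simp add: vel3_def) (intro continuous_intros)

lemma piecewise_continuous_piecewise_polynomial:
  assumes "piecewise_polynomial Z F"
  shows "piecewise_continuous (mesh Z) (\<lambda>x. F x $ m)"
proof (rule piecewise_continuousI)
  fix U assume "U \<in> mesh Z"
  then obtain p where p: "polynomial_function p" "\<forall>x\<in>U. F x = p x"
    using assms unfolding piecewise_polynomial_def mesh_def by blast
  then show "\<exists>q. continuous_on UNIV q \<and> (\<forall>x\<in>U. F x $ m = q x)"
    by (intro exI[of _ "\<lambda>x. p x $ m"])
      (auto intro!: continuous_on_polymonial_function continuous_intros)
qed

lemma diag_mult_component: "(diag d *v w) $ l = d l * w $ l"
proof -
  have "(diag d *v w) $ l = (\<Sum>m\<in>UNIV. if l = m then d l * w $ m else 0)"
    unfolding matrix_vector_mult_def diag_def by (simp only: vec_lambda_beta) (rule sum.cong; simp)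
  then show ?thesis by simp
qed

lemma block_diag_mult_diag_inner:
  "block_diag_mult (diag a) (diag b) w \<bullet> w'
    = (\<Sum>l\<in>UNIV. a l * (fst w $ l * fst w' $ l)) + (\<Sum>l\<in>UNIV. b l * (snd w $ l * snd w' $ l))"
  by (simp add: block_diag_mult_def inner_prod_def inner_vec_def diag_mult_component mult.assoc)

section \<open>Integrals over the product domain\<close>

context
  fixes X :: "('dx::finite) fe" and V :: "('dv::finite) fe"
  assumes X: "lagrange_fe X" and V: "lagrange_fe V"
begin

abbreviation cell_products :: "((real^'dx) \<times> (real^'dv)) set set" where
  "cell_products \<equiv> product_mesh (mesh X) (mesh V)"

lemma msize_pos: "msize X $ l > 0" "msize V $ m > 0"
  using X V by (auto simp: lagrange_fe_def)

lemma shape_in_fe_space: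
  "i \<in> idx X \<Longrightarrow> shape X i \<in> fe_space X" "j \<in> idx V \<Longrightarrow> shape V j \<in> fe_space V"
  using X V by (auto simp: lagrange_fe_def)

lemma finite_cell_products: "finite cell_products"
  unfolding product_mesh_def by (intro finite_imageI finite_cartesian_product finite_mesh)

lemma open_bounded_cell_products: "U \<in> cell_products \<Longrightarrow> open U \<and> bounded U"
  using open_bounded_mesh[of _ X] open_bounded_mesh[of _ V]
  by (auto simp: product_mesh_def open_Times bounded_Times)

lemma set_integrable_cell_products:
  "piecewise_continuous cell_products g \<Longrightarrow> set_integrable lborel (\<Union>cell_products) g"
  by (rule set_integrable_piecewise_continuous[OF finite_cell_products open_bounded_cell_products])

lemma domain_integral:
  assumes "piecewise_continuous cell_products g"
  shows "g integrable_on \<Union>cell_products"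
    and "(LINT z:dom_box X \<times> dom_box V|lebesgue. g z) = integral (\<Union>cell_products) g"
    and "(LINT z:dom_box X \<times> dom_box V|lebesgue. g z) = (LINT z:\<Union>cell_products|lborel. g z)"
proof -
  have "\<Union>cell_products \<subseteq> dom_box X \<times> dom_box V"
    using Union_mesh_subset_dom_box[OF msize_pos(1)] Union_mesh_subset_dom_box[OF msize_pos(2)]
    unfolding Union_product_mesh by (rule Sigma_mono)
  note * = finite_cell_products open_bounded_cell_products this
    negligible_product_mesh_complement[OF msize_pos] assms
  show "g integrable_on \<Union>cell_products"
    by (rule set_lebesgue_integral_piecewise_continuous(1)[OF *])
  show "(LINT z:dom_box X \<times> dom_box V|lebesgue. g z) = integral (\<Union>cell_products) g"
    by (rule set_lebesgue_integral_piecewise_continuous(2)[OF *])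
  show "(LINT z:dom_box X \<times> dom_box V|lebesgue. g z) = (LINT z:\<Union>cell_products|lborel. g z)"
    by (rule set_lebesgue_integral_piecewise_continuous(3)[OF *])
qed

section \<open>Integrals of partial derivatives over the product domain\<close>

text \<open>
  The weight is constant in the direction of the derivative, so on each line in that direction it
  can be taken out of the integral, which then vanishes by periodicity of \<open>u\<close>.
\<close>

lemma integral_weighted_partial_x:
  assumes u: "u \<in> fe_space X" and w: "piecewise_continuous cell_products w"
    and shift: "\<And>x v s. w (x + s *\<^sub>R axis l 1, v) = w (x, v)"
  shows "integral (\<Union>cell_products) (\<lambda>z. w z * partial l u (fst z)) = 0"
proof -
  have pc: "piecewise_continuous cell_products (\<lambda>z. w z * partial l u (fst z))"
    by (intro piecewise_continuous_mult w piecewise_continuous_fst piecewise_continuous_partial u)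
  let ?F = "\<lambda>z. indicator (\<Union>cell_products) z *\<^sub>R (w z * partial l u (fst z))"
  have "(LINT z|lborel. ?F z) = 0"
  proof (rule integral_eq_0_if_line_integrals_eq_0[where b = "(axis l 1, 0)"])
    show "(axis l 1, 0) \<in> (Basis :: ((real^'dx) \<times> (real^'dv)) set)"
      by (simp add: Basis_prod_def axis_in_Basis_iff)
    show "integrable lborel ?F"
      using set_integrable_cell_products[OF pc] by (simp add: set_integrable_def)
    fix z :: "(real^'dx) \<times> (real^'dv)"
    obtain x v where z: "z = (x, v)" by (cases z)
    have eq: "?F (z + s *\<^sub>R (axis l 1, 0)) = (indicator (\<Union>(mesh V)) v * w (x, v)) *
        (indicator (\<Union>(mesh X)) (x + s *\<^sub>R axis l 1) * partial l u (x + s *\<^sub>R axis l 1))" for s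
      unfolding Union_product_mesh z by (simp add: shift indicator_times)
    have "((\<lambda>s. ?F (z + s *\<^sub>R (axis l 1, 0))) has_integral 0) UNIV"
      unfolding eq using has_integral_mult_right[OF has_integral_partial_along_line[OF msize_pos(1) u]]
      by simp
    then show "(LINT s|lborel. ?F (z + s *\<^sub>R (axis l 1, 0))) = 0"
      by (rule lborel_integral_eq_0_if_has_integral_0)
  qed
  then show ?thesis
    using domain_integral(2,3)[OF pc] by (simp add: set_lebesgue_integral_def)
qed

lemma integral_weighted_partial_v:
  assumes u: "u \<in> fe_space V" and w: "piecewise_continuous cell_products w"
    and shift: "\<And>x v s. w (x, v + s *\<^sub>R axis l 1) = w (x, v)"
  shows "integral (\<Union>cell_products) (\<lambda>z. w z * partial l u (snd z)) = 0"
proof -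
  have pc: "piecewise_continuous cell_products (\<lambda>z. w z * partial l u (snd z))"
    by (intro piecewise_continuous_mult w piecewise_continuous_snd piecewise_continuous_partial u)
  let ?F = "\<lambda>z. indicator (\<Union>cell_products) z *\<^sub>R (w z * partial l u (snd z))"
  have "(LINT z|lborel. ?F z) = 0"
  proof (rule integral_eq_0_if_line_integrals_eq_0[where b = "(0, axis l 1)"])
    show "(0, axis l 1) \<in> (Basis :: ((real^'dx) \<times> (real^'dv)) set)"
      by (simp add: Basis_prod_def axis_in_Basis_iff)
    show "integrable lborel ?F"
      using set_integrable_cell_products[OF pc] by (simp add: set_integrable_def)
    fix z :: "(real^'dx) \<times> (real^'dv)"
    obtain x v where z: "z = (x, v)" by (cases z)
    have eq: "?F (z + s *\<^sub>R (0, axis l 1)) = (indicator (\<Union>(mesh X)) x * w (x, v)) *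
        (indicator (\<Union>(mesh V)) (v + s *\<^sub>R axis l 1) * partial l u (v + s *\<^sub>R axis l 1))" for s
      unfolding Union_product_mesh z by (simp add: shift indicator_times)
    have "((\<lambda>s. ?F (z + s *\<^sub>R (0, axis l 1))) has_integral 0) UNIV"
      unfolding eq using has_integral_mult_right[OF has_integral_partial_along_line[OF msize_pos(2) u]]
      by simp
    then show "(LINT s|lborel. ?F (z + s *\<^sub>R (0, axis l 1))) = 0"
      by (rule lborel_integral_eq_0_if_has_integral_0)
  qed
  then show ?thesis
    using domain_integral(2,3)[OF pc] by (simp add: set_lebesgue_integral_def)
qed

section \<open>The tensor product basis\<close>

lemma piecewise_continuous_shape_x:
  assumes "i \<in> idx X"
  shows "piecewise_continuous cell_products (\<lambda>z. shape X i (fst z))"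
    and "piecewise_continuous cell_products (\<lambda>z. partial l (shape X i) (fst z))"
  using assms by (auto intro!: piecewise_continuous_fst piecewise_continuous_fe_space
      piecewise_continuous_partial shape_in_fe_space)

lemma piecewise_continuous_shape_v:
  assumes "j \<in> idx V"
  shows "piecewise_continuous cell_products (\<lambda>z. shape V j (snd z))"
    and "piecewise_continuous cell_products (\<lambda>z. partial l (shape V j) (snd z))"
  using assms by (auto intro!: piecewise_continuous_snd piecewise_continuous_fe_space
      piecewise_continuous_partial shape_in_fe_space)

lemma piecewise_continuous_psi:
  assumes "i \<in> idx X \<times> idx V"
  shows "piecewise_continuous cell_products (psi X V i)"
  using assms unfolding psi_def
  by (intro piecewise_continuous_mult piecewise_continuous_shape_x piecewise_continuous_shape_v)
    (auto simp: mem_Times_iff)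

lemma grad_psi:
  assumes i: "i \<in> idx X \<times> idx V" and z: "z \<in> \<Union>cell_products"
  shows "grad (psi X V i) z =
    ((\<chi> l. partial l (shape X (fst i)) (fst z) * shape V (snd i) (snd z)),
     (\<chi> l. shape X (fst i) (fst z) * partial l (shape V (snd i)) (snd z)))"
proof -
  have z': "fst z \<in> \<Union>(mesh X)" "snd z \<in> \<Union>(mesh V)"
    using z unfolding Union_product_mesh by (auto simp: mem_Times_iff)
  have i': "shape X (fst i) \<in> fe_space X" "shape V (snd i) \<in> fe_space V"
    using i shape_in_fe_space by (auto simp: mem_Times_iff)
  have "partial l (\<lambda>x. psi X V i (x, snd z)) (fst z)
      = partial l (shape X (fst i)) (fst z) * shape V (snd i) (snd z)" for l
    using DERIV_cmult_right[OF fe_space_has_partial[OF i'(1) z'(1), of l], of "shape V (snd i) (snd z)"]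
    unfolding psi_def partial_def[of l "\<lambda>x. shape X (fst i) _ * _"]
    by (simp add: DERIV_imp_deriv partial_def[of l "\<lambda>x. shape X (fst i) x * _"])
  moreover have "partial l (\<lambda>v. psi X V i (fst z, v)) (snd z)
      = shape X (fst i) (fst z) * partial l (shape V (snd i)) (snd z)" for l
    using DERIV_cmult[OF fe_space_has_partial[OF i'(2) z'(2), of l], of "shape X (fst i) (fst z)"]
    unfolding psi_def
    by (simp add: DERIV_imp_deriv partial_def[of l "\<lambda>v. _ * shape V (snd i) v"])
  ultimately show ?thesis by (simp add: grad_def)
qed

lemma sum_psi_eq_1:
  assumes "z \<in> \<Union>cell_products"
  shows "(\<Sum>i\<in>idx X \<times> idx V. psi X V i z) = 1"
proof -
  have "(\<Sum>i\<in>idx X \<times> idx V. psi X V i z)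
      = (\<Sum>i\<in>idx X. shape X i (fst z)) * (\<Sum>j\<in>idx V. shape V j (snd z))"
    by (simp add: psi_def sum_product sum.cartesian_product case_prod_unfold)
  then show ?thesis
    using assms shape_partition_of_unity[OF X] shape_partition_of_unity[OF V]
    unfolding Union_product_mesh by (simp add: mem_Times_iff)
qed

lemma sum_grad_psi_eq_0:
  assumes z: "z \<in> \<Union>cell_products"
  shows "(\<Sum>i\<in>idx X \<times> idx V. grad (psi X V i) z) = 0"
proof -
  have z': "fst z \<in> \<Union>(mesh X)" "snd z \<in> \<Union>(mesh V)"
    using z unfolding Union_product_mesh by (auto simp: mem_Times_iff)
  have "(\<Sum>i\<in>idx X \<times> idx V. partial l (shape X (fst i)) (fst z) * shape V (snd i) (snd z))
      = (\<Sum>i\<in>idx X. partial l (shape X i) (fst z)) * (\<Sum>j\<in>idx V. shape V j (snd z))" for l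
    by (simp add: sum_product sum.cartesian_product case_prod_unfold)
  then have 1: "(\<Sum>i\<in>idx X \<times> idx V. partial l (shape X (fst i)) (fst z) * shape V (snd i) (snd z)) = 0" for l
    using sum_partial_shape_eq_0[OF X z'(1)] by simp
  have "(\<Sum>i\<in>idx X \<times> idx V. shape X (fst i) (fst z) * partial l (shape V (snd i)) (snd z))
      = (\<Sum>i\<in>idx X. shape X i (fst z)) * (\<Sum>j\<in>idx V. partial l (shape V j) (snd z))" for l
    by (simp add: sum_product sum.cartesian_product case_prod_unfold)
  then have 2: "(\<Sum>i\<in>idx X \<times> idx V. shape X (fst i) (fst z) * partial l (shape V (snd i)) (snd z)) = 0" for l
    using sum_partial_shape_eq_0[OF V z'(2)] by simp
  show ?thesis
    using 1 2 by (simp add: grad_psi[OF _ z] prod_eq_iff fst_sum snd_sum vec_eq_iff)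
qed

lemma piecewise_continuous_grad_psi:
  assumes i: "i \<in> idx X \<times> idx V"
  shows "piecewise_continuous cell_products (\<lambda>z. fst (grad (psi X V i) z) $ l)"
    and "piecewise_continuous cell_products (\<lambda>z. snd (grad (psi X V i) z) $ m)"
proof -
  have i': "fst i \<in> idx X" "snd i \<in> idx V" using i by auto
  show "piecewise_continuous cell_products (\<lambda>z. fst (grad (psi X V i) z) $ l)"
    by (rule piecewise_continuous_cong[where
          h = "\<lambda>z. partial l (shape X (fst i)) (fst z) * shape V (snd i) (snd z)"])
      (auto intro!: piecewise_continuous_mult piecewise_continuous_shape_x
        piecewise_continuous_shape_v i' simp: grad_psi[OF i] simp del: Union_iff)
  show "piecewise_continuous cell_products (\<lambda>z. snd (grad (psi X V i) z) $ m)"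
    by (rule piecewise_continuous_cong[where
          h = "\<lambda>z. shape X (fst i) (fst z) * partial m (shape V (snd i)) (snd z)"])
      (auto intro!: piecewise_continuous_mult piecewise_continuous_shape_x
        piecewise_continuous_shape_v i' simp: grad_psi[OF i] simp del: Union_iff)
qed

section \<open>Column sums of the matrices\<close>

text \<open>
  A column sum of one of the matrices of the scheme is the same bilinear form, tested with the sum of
  the test functions.
\<close>

lemma sum_l2ip_right:
  assumes "finite I"
    and "\<And>i. i \<in> I \<Longrightarrow> piecewise_continuous cell_products (\<lambda>z. g z \<bullet> h i z)"
  shows "(\<Sum>i\<in>I. l2ip (dom_box X \<times> dom_box V) g (h i))
    = integral (\<Union>cell_products) (\<lambda>z. g z \<bullet> (\<Sum>i\<in>I. h i z))"
proof -
  have "(\<Sum>i\<in>I. l2ip (dom_box X \<times> dom_box V) g (h i))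
      = (\<Sum>i\<in>I. integral (\<Union>cell_products) (\<lambda>z. g z \<bullet> h i z))"
    unfolding l2ip_def by (intro sum.cong refl domain_integral(2) assms)
  also have "\<dots> = integral (\<Union>cell_products) (\<lambda>z. \<Sum>i\<in>I. g z \<bullet> h i z)"
    using assms domain_integral(1) by (intro integral_sum[symmetric]) auto
  finally show ?thesis by (simp add: inner_sum_right)
qed

lemma finite_tensor_idx: "finite (idx X \<times> idx V)"
  by (intro finite_cartesian_product finite_idx)

lemma sum_mass_mat:
  assumes j: "j \<in> idx X \<times> idx V"
  shows "(\<Sum>i\<in>idx X \<times> idx V. mass_mat X V i j) = integral (\<Union>cell_products) (psi X V j)"
proof -
  have "(\<Sum>i\<in>idx X \<times> idx V. mass_mat X V i j)
      = integral (\<Union>cell_products) (\<lambda>z. psi X V j z \<bullet> (\<Sum>i\<in>idx X \<times> idx V. psi X V i z))"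
    unfolding mass_mat_def
    by (rule sum_l2ip_right[OF finite_tensor_idx])
      (auto intro!: piecewise_continuous_mult piecewise_continuous_psi j)
  also have "\<dots> = integral (\<Union>cell_products) (psi X V j)"
    by (rule Henstock_Kurzweil_Integration.integral_cong) (simp add: sum_psi_eq_1 del: Union_iff)
  finally show ?thesis .
qed

lemma sum_visc_mat:
  assumes j: "j \<in> idx X \<times> idx V"
    and a: "\<And>l. piecewise_continuous (mesh X) (\<lambda>x. a x l)"
    and b: "\<And>l. piecewise_continuous (mesh V) (\<lambda>v. b v l)"
  shows "(\<Sum>i\<in>idx X \<times> idx V. visc_mat X V (\<lambda>x. diag (a x)) (\<lambda>v. diag (b v)) i j) = 0"
proof -
  have "(\<Sum>i\<in>idx X \<times> idx V. visc_mat X V (\<lambda>x. diag (a x)) (\<lambda>v. diag (b v)) i j)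
      = integral (\<Union>cell_products)
        (\<lambda>z. block_diag_mult (diag (a (fst z))) (diag (b (snd z))) (grad (psi X V j) z)
          \<bullet> (\<Sum>i\<in>idx X \<times> idx V. grad (psi X V i) z))"
    unfolding visc_mat_def
    by (rule sum_l2ip_right[OF finite_tensor_idx], unfold block_diag_mult_diag_inner)
      (intro piecewise_continuous_add piecewise_continuous_sum piecewise_continuous_mult
        piecewise_continuous_fst piecewise_continuous_snd piecewise_continuous_grad_psi j a b)
  also have "\<dots> = integral (\<Union>cell_products) (\<lambda>z. 0)"
    by (rule Henstock_Kurzweil_Integration.integral_cong) (simp add: sum_grad_psi_eq_0 del: Union_iff)
  finally show ?thesis by simp
qed

lemma piecewise_continuous_advection:
  assumes E: "piecewise_polynomial X E" and B: "piecewise_polynomial X B"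
  shows "piecewise_continuous cell_products (\<lambda>z. fst (advection cx cv E B z) $ l)"
    and "piecewise_continuous cell_products (\<lambda>z. snd (advection cx cv E B z) $ m)"
proof -
  have v: "piecewise_continuous cell_products (\<lambda>z. vel3 cv (snd z) $ n)" for n
    by (intro piecewise_continuous_snd piecewise_continuous_if_continuous continuous_on_vel3)
  have EB: "piecewise_continuous cell_products (\<lambda>z. E (fst z) $ n)"
    "piecewise_continuous cell_products (\<lambda>z. B (fst z) $ n)" for n
    by (intro piecewise_continuous_fst piecewise_continuous_piecewise_polynomial E B)+
  have neg: "piecewise_continuous cell_products (\<lambda>z. g z - h z)"
    if "piecewise_continuous cell_products g" "piecewise_continuous cell_products h" for g h
    using piecewise_continuous_add[OF that(1) piecewise_continuous_mult[OF
          piecewise_continuous_if_continuous[of "\<lambda>_. -1"] that(2)]] by simp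
  have "piecewise_continuous cell_products (\<lambda>z. cross3 (vel3 cv (snd z)) (B (fst z)) $ n)" for n
    using exhaust_3[of n] by (auto simp: cross3_def intro!: neg piecewise_continuous_mult v EB)
  then show "piecewise_continuous cell_products (\<lambda>z. snd (advection cx cv E B z) $ m)"
    by (simp add: advection_def piecewise_continuous_add EB)
  show "piecewise_continuous cell_products (\<lambda>z. fst (advection cx cv E B z) $ l)"
    by (simp add: advection_def v)
qed

text \<open>
  After testing with \<open>1\<close>, each of the terms \<open>\<beta>\<^sub>l \<partial>\<^sub>l psi\<close> is split into the derivative of one factor
  of \<open>psi\<close> and the weight \<open>wx l\<close> or \<open>wv l\<close>, which contains the other factor and \<open>\<beta>\<^sub>l\<close>
  and is constant in the direction \<open>l\<close>.
\<close>

lemma sum_conv_mat: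
  assumes E: "piecewise_polynomial X E" and B: "piecewise_polynomial X B"
    and j: "j \<in> idx X \<times> idx V"
  shows "(\<Sum>i\<in>idx X \<times> idx V. conv_mat X V (advection cx cv E B) i j) = 0"
proof -
  let ?\<beta> = "advection cx cv E B" and ?D = "\<Union>cell_products"
  have j': "fst j \<in> idx X" "snd j \<in> idx V" using j by auto
  note \<beta> = piecewise_continuous_advection[OF E B]
  define wx where "wx l z = fst (?\<beta> z) $ l * shape V (snd j) (snd z)" for l z
  define wv where "wv l z = snd (?\<beta> z) $ l * shape X (fst j) (fst z)" for l z
  have wx: "piecewise_continuous cell_products (wx l)" for l
    unfolding wx_def by (intro piecewise_continuous_mult \<beta> piecewise_continuous_shape_v j')
  have wv: "piecewise_continuous cell_products (wv l)" for l
    unfolding wv_def by (intro piecewise_continuous_mult \<beta> piecewise_continuous_shape_x j')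
  have x0: "integral ?D (\<lambda>z. wx l z * partial l (shape X (fst j)) (fst z)) = 0" for l
    by (rule integral_weighted_partial_x[OF shape_in_fe_space(1)[OF j'(1)] wx])
      (simp add: wx_def advection_def)
  have v0: "integral ?D (\<lambda>z. wv l z * partial l (shape V (snd j)) (snd z)) = 0" for l
  proof (rule integral_weighted_partial_v[OF shape_in_fe_space(2)[OF j'(2)] wv])
    fix x v s
    have "cross3 (vel3 cv (v + s *\<^sub>R axis l 1)) (B x) $ cv l = cross3 (vel3 cv v) (B x) $ cv l"
      by (intro cross3_component_cong vel3_shift)
    then show "wv l (x, v + s *\<^sub>R axis l 1) = wv l (x, v)"
      by (simp add: wv_def advection_def)
  qed
  have ix: "(\<lambda>z. wx l z * partial l (shape X (fst j)) (fst z)) integrable_on ?D" for l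
    by (intro domain_integral(1) piecewise_continuous_mult wx piecewise_continuous_shape_x j')
  have iv: "(\<lambda>z. wv l z * partial l (shape V (snd j)) (snd z)) integrable_on ?D" for l
    by (intro domain_integral(1) piecewise_continuous_mult wv piecewise_continuous_shape_v j')
  have "(\<Sum>i\<in>idx X \<times> idx V. conv_mat X V ?\<beta> i j)
      = integral ?D (\<lambda>z. (?\<beta> z \<bullet> grad (psi X V j) z) \<bullet> (\<Sum>i\<in>idx X \<times> idx V. psi X V i z))"
    unfolding conv_mat_def
    by (rule sum_l2ip_right[OF finite_tensor_idx], unfold inner_prod_def inner_vec_def inner_real_def)
      (intro piecewise_continuous_add piecewise_continuous_sum piecewise_continuous_mult \<beta>
        piecewise_continuous_grad_psi piecewise_continuous_psi j)
  also have "\<dots> = integral ?D (\<lambda>z. (\<Sum>l\<in>UNIV. wx l z * partial l (shape X (fst j)) (fst z))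
      + (\<Sum>l\<in>UNIV. wv l z * partial l (shape V (snd j)) (snd z)))"
    by (rule Henstock_Kurzweil_Integration.integral_cong)
      (simp add: sum_psi_eq_1 grad_psi[OF j] inner_prod_def inner_vec_def wx_def wv_def ac_simps del: Union_iff)
  also have "\<dots> = (\<Sum>l\<in>UNIV. integral ?D (\<lambda>z. wx l z * partial l (shape X (fst j)) (fst z)))
      + (\<Sum>l\<in>UNIV. integral ?D (\<lambda>z. wv l z * partial l (shape V (snd j)) (snd z)))"
    by (simp only: Henstock_Kurzweil_Integration.integral_add integrable_sum integral_sum
        finite ix iv)
  also have "\<dots> = 0" using x0 v0 by simp
  finally show ?thesis .
qed

lemma integral_fh:
  "(LINT z:dom_box X \<times> dom_box V|lebesgue. fh X V a z)
    = (\<Sum>j\<in>idx X \<times> idx V. a j * integral (\<Union>cell_products) (psi X V j))"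
proof -
  have pc: "piecewise_continuous cell_products (\<lambda>z. a j * psi X V j z)" if "j \<in> idx X \<times> idx V" for j
    using that by (intro piecewise_continuous_mult piecewise_continuous_psi
        piecewise_continuous_if_continuous continuous_on_const)
  have "(LINT z:dom_box X \<times> dom_box V|lebesgue. fh X V a z)
      = integral (\<Union>cell_products) (\<lambda>z. \<Sum>j\<in>idx X \<times> idx V. a j * psi X V j z)"
    unfolding fh_def by (intro domain_integral(2) piecewise_continuous_sum pc)
  also have "\<dots> = (\<Sum>j\<in>idx X \<times> idx V. integral (\<Union>cell_products) (\<lambda>z. a j * psi X V j z))"
    by (intro integral_sum finite_tensor_idx domain_integral(1) pc)
  finally show ?thesis by simp
qed

text \<open>
  The mechanism of conservation, for any field and viscosity: it is enough that the columns of the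
  convection and viscosity matrices sum to zero.
\<close>

lemma forward_euler_step_conservative:
  assumes step: "forward_euler_step X V t \<beta> Ax Av f n" and dt: "t (n + 1) \<noteq> t n"
    and conv: "\<And>j. j \<in> idx X \<times> idx V \<Longrightarrow> (\<Sum>i\<in>idx X \<times> idx V. conv_mat X V \<beta> i j) = 0"
    and visc: "\<And>j. j \<in> idx X \<times> idx V \<Longrightarrow> (\<Sum>i\<in>idx X \<times> idx V. visc_mat X V Ax Av i j) = 0"
  shows "(LINT z:dom_box X \<times> dom_box V|lebesgue. fh X V (f (n + 1)) z)
    = (LINT z:dom_box X \<times> dom_box V|lebesgue. fh X V (f n) z)"
proof -
  let ?I = "idx X \<times> idx V"
  have column: "(\<Sum>i\<in>?I. \<Sum>j\<in>?I. A i j * r j) = (\<Sum>j\<in>?I. (\<Sum>i\<in>?I. A i j) * r j)"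
    for A :: "_ \<Rightarrow> _ \<Rightarrow> real" and r
    by (subst sum.swap) (simp add: sum_distrib_right)
  \<comment> \<open>Adding all equations is testing with the sum of all test functions.\<close>
  have "0 = (\<Sum>i\<in>?I.
        (\<Sum>j\<in>?I. mass_mat X V i j * ((f (n + 1) j - f n j) / (t (n + 1) - t n)))
        + (\<Sum>j\<in>?I. conv_mat X V \<beta> i j * f n j)
        + (\<Sum>j\<in>?I. visc_mat X V Ax Av i j * f n j))"
    using step unfolding forward_euler_step_def by (rule sum.neutral[symmetric])
  also have "\<dots> = (\<Sum>j\<in>?I. (\<Sum>i\<in>?I. mass_mat X V i j) * ((f (n + 1) j - f n j) / (t (n + 1) - t n)))
        + (\<Sum>j\<in>?I. (\<Sum>i\<in>?I. conv_mat X V \<beta> i j) * f n j)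
        + (\<Sum>j\<in>?I. (\<Sum>i\<in>?I. visc_mat X V Ax Av i j) * f n j)"
    unfolding sum.distrib column ..
  also have "\<dots> = (\<Sum>j\<in>?I. integral (\<Union>cell_products) (psi X V j)
      * ((f (n + 1) j - f n j) / (t (n + 1) - t n)))"
    by (simp add: conv visc sum_mass_mat)
  also have "\<dots> = ((\<Sum>j\<in>?I. f (n + 1) j * integral (\<Union>cell_products) (psi X V j))
      - (\<Sum>j\<in>?I. f n j * integral (\<Union>cell_products) (psi X V j))) / (t (n + 1) - t n)"
    by (simp add: sum_subtractf[symmetric] sum_divide_distrib algebra_simps)
  finally show ?thesis using dt unfolding integral_fh by simp
qed

end

section \<open>Conservation\<close>

theorem proposition4:
  fixes X :: "('dx::finite) fe" and V :: "('dv::finite) fe"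
    and cx :: "'dx \<Rightarrow> 3" and cv :: "'dv \<Rightarrow> 3"
    and t :: "int \<Rightarrow> real"
    and E B :: "int \<Rightarrow> real^'dx \<Rightarrow> real^3"
    and \<beta> :: "int \<Rightarrow> (real^'dx) \<times> (real^'dv) \<Rightarrow> (real^'dx) \<times> (real^'dv)"
    and f :: "int \<Rightarrow> (nat^'dx) \<times> (nat^'dv) \<Rightarrow> real"
    and Rx :: "int \<Rightarrow> real^'dx \<Rightarrow> real" and Rv :: "int \<Rightarrow> real^'dv \<Rightarrow> real"
  assumes "lagrange_fe X" and "lagrange_fe V" and "degr X = degr V"
    and "inj cx" and "inj cv" and "range cx \<subseteq> range cv"
    and "strict_mono_on {-2..} t"
    and "\<And>n. n \<ge> 0 \<Longrightarrow> piecewise_polynomial X (E n)"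
    and "\<And>n. n \<ge> 0 \<Longrightarrow> piecewise_polynomial X (B n)"
    and "\<And>n. n \<ge> 0 \<Longrightarrow> \<beta> n = advection cx cv (E n) (B n)"
    and "\<And>n. n \<ge> 0 \<Longrightarrow> abs_projection X (residual_x X V t \<beta> f n) (Rx n)"
    and "\<And>n. n \<ge> 0 \<Longrightarrow> abs_projection V (residual_v X V t \<beta> f n) (Rv n)"
    and "\<And>n. n \<ge> 0 \<Longrightarrow> spread X (idx X) (dens_x X V (f n)) \<noteq> 0"
    and "\<And>n. n \<ge> 0 \<Longrightarrow> spread V (idx V) (dens_v X V (f n)) \<noteq> 0"
    and "\<And>n. n \<ge> 0 \<Longrightarrow> forward_euler_step X V t (\<beta> n)
           (AH_x X V (\<beta> n) (f n) (Rx n)) (AH_v X V (\<beta> n) (f n) (Rv n)) f n"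
  shows "\<forall>n\<ge>0. (LINT z:dom_box X \<times> dom_box V|lebesgue. fh X V (f (n + 1)) z)
              = (LINT z:dom_box X \<times> dom_box V|lebesgue. fh X V (f n) z)"
proof (intro allI impI)
  fix n :: int assume n: "n \<ge> 0"
  show "(LINT z:dom_box X \<times> dom_box V|lebesgue. fh X V (f (n + 1)) z)
      = (LINT z:dom_box X \<times> dom_box V|lebesgue. fh X V (f n) z)"
  proof (rule forward_euler_step_conservative[OF assms(1,2) assms(15)[OF n]])
    show "t (n + 1) \<noteq> t n"
      using strict_mono_onD[OF assms(7), of n "n + 1"] n by simp
    fix j assume j: "j \<in> idx X \<times> idx V"
    show "(\<Sum>i\<in>idx X \<times> idx V. conv_mat X V (\<beta> n) i j) = 0"
      unfolding assms(10)[OF n] by (rule sum_conv_mat) (use assms n j in auto)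
    show "(\<Sum>i\<in>idx X \<times> idx V. visc_mat X V
        (AH_x X V (\<beta> n) (f n) (Rx n)) (AH_v X V (\<beta> n) (f n) (Rv n)) i j) = 0"
      unfolding AH_x_def AH_v_def
      by (rule sum_visc_mat[OF assms(1,2) j])
        (intro piecewise_continuous_if_continuous continuous_on_interp assms)+
  qed
qed

end
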